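(* Let $K$ be a field and let $H=(H^0,H^1,s,r)$ be a hypergraph. Then $L_K(H)$ is a domain if and only if $|H^0|=1$ and any $h\in H^1$ has the property that either $|s(h)|,|r(h)|\geq 2$ or $|s(h)|=|r(h)|=1$.
   Context: Algebras are associative but not necessarily unital. A multiset over a set $Y$ is a function $M:Y\to\mathbb N_0$; its support is $M_{\mathrm{supp}}=\{y\in Y\mid M(y)>0\}$. $\mathrm{Mult}(Y)$ is the set of multisets over $Y$ with finite, nonempty support, and $|M|=\sum_{y\in M_{\mathrm{supp}}}M(y)$. A (directed) hypergraph is a quadruple $H=(H^0,H^1,s,r)$ where $H^0,H^1$ are sets and $s,r:H^1\to\mathrm{Mult}(H^0)$ are maps. All hypergraphs are assumed nonempty (not $H^0=H^1=\emptyset$). For each $h\in H^1$ fix listings with multiplicity $s(h)=\{s(h)_1,\dots,s(h)_{|s(h)|}\}$ and $r(h)=\{r(h)_1,\dots,r(h)_{|r(h)|}\}$. The Leavitt path algebra $L_K(H)$ is the (not necessarily unital) $K$-algebra presented by the generators $v,h_{ij},h_{ij}^*$ ($v\in H^0$, $h\in H^1$, $1\le i\le|s(h)|$, $1\le j\le|r(h)|$) and the relations: (i) $uv=\delta_{uv}u$ ($u,v\in H^0$); (ii) $s(h)_ih_{ij}=h_{ij}=h_{ij}r(h)_j$ and $r(h)_jh_{ij}^*=h_{ij}^*=h_{ij}^*s(h)_i$ for all $h,i,j$; (iii) $\sum_{k=1}^{|r(h)|}h_{ik}h_{jk}^*=\delta_{ij}s(h)_i$ ($h\in H^1$, $1\le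 i,j\le|s(h)|$); (iv) $\sum_{k=1}^{|s(h)|}h_{ki}^*h_{kj}=\delta_{ij}r(h)_i$ ($h\in H^1$, $1\le i,j\le|r(h)|$). A domain is a nonzero (not necessarily commutative) ring without zero divisors. *)

theory Defs
  imports "HOL-Library.Poly_Mapping" "HOL-Library.Multiset"
begin

text \<open>
  The ring record of HOL-Algebra has a distinguished unit, so structures without unit get a
  record of their own.
\<close>

record ('k, 'a) nu_alg =
  carr :: "'a set"
  add :: "'a \<Rightarrow> 'a \<Rightarrow> 'a"
  zero :: 'a
  mult :: "'a \<Rightarrow> 'a \<Rightarrow> 'a"
  scale :: "'k \<Rightarrow> 'a \<Rightarrow> 'a"

locale nu_ring =
  fixes A :: "('k, 'a) nu_alg"
  assumes add_closed: "x \<in> carr A \<Longrightarrow> y \<in> carr A \<Longrightarrow> add A x y \<in> carr A"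
    and zero_closed: "zero A \<in> carr A"
    and mult_closed: "x \<in> carr A \<Longrightarrow> y \<in> carr A \<Longrightarrow> mult A x y \<in> carr A"
    and add_assoc: "x \<in> carr A \<Longrightarrow> y \<in> carr A \<Longrightarrow> z \<in> carr A \<Longrightarrow>
      add A (add A x y) z = add A x (add A y z)"
    and add_commute: "x \<in> carr A \<Longrightarrow> y \<in> carr A \<Longrightarrow> add A x y = add A y x"
    and add_zero: "x \<in> carr A \<Longrightarrow> add A (zero A) x = x"
    and add_inverse: "x \<in> carr A \<Longrightarrow> \<exists>y\<in>carr A. add A y x = zero A"
    and mult_assoc: "x \<in> carr A \<Longrightarrow> y \<in> carr A \<Longrightarrow> z \<in> carr A \<Longrightarrow>
      mult A (mult A x y) z = mult A x (mult A y z)"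
    and distrib_right: "x \<in> carr A \<Longrightarrow> y \<in> carr A \<Longrightarrow> z \<in> carr A \<Longrightarrow>
      mult A (add A x y) z = add A (mult A x z) (mult A y z)"
    and distrib_left: "x \<in> carr A \<Longrightarrow> y \<in> carr A \<Longrightarrow> z \<in> carr A \<Longrightarrow>
      mult A z (add A x y) = add A (mult A z x) (mult A z y)"

locale nu_algebra = nu_ring A for A :: "('k::field, 'a) nu_alg" +
  assumes scale_closed: "x \<in> carr A \<Longrightarrow> scale A c x \<in> carr A"
    and scale_add_right: "x \<in> carr A \<Longrightarrow> y \<in> carr A \<Longrightarrow>
      scale A c (add A x y) = add A (scale A c x) (scale A c y)"
    and scale_add_left: "x \<in> carr A \<Longrightarrow> scale A (c + d) x = add A (scale A c x) (scale A d x)"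
    and scale_scale: "x \<in> carr A \<Longrightarrow> scale A c (scale A d x) = scale A (c * d) x"
    and scale_one: "x \<in> carr A \<Longrightarrow> scale A 1 x = x"
    and scale_mult_left: "x \<in> carr A \<Longrightarrow> y \<in> carr A \<Longrightarrow>
      mult A (scale A c x) y = scale A c (mult A x y)"
    and scale_mult_right: "x \<in> carr A \<Longrightarrow> y \<in> carr A \<Longrightarrow>
      mult A x (scale A c y) = scale A c (mult A x y)"

locale nu_domain = nu_ring +
  assumes nonzero: "carr A \<noteq> {zero A}"
    and no_zero_divisors: "x \<in> carr A \<Longrightarrow> y \<in> carr A \<Longrightarrow> mult A x y = zero A \<Longrightarrow>
      x = zero A \<or> y = zero A"

text \<open>
  The wrapper type makes words an additive monoid (with concatenation as addition), so that
  \<^typ>\<open>'g \<Rightarrow>\<^sub>0 'k\<close> over words carries the convolution product of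
  \<^theory>\<open>HOL-Library.Poly_Mapping\<close>; this is the free unital algebra.
\<close>

datatype 'g word = Word (letters: "'g list")

instantiation word :: (type) monoid_add
begin

definition zero_word :: "'a word" where
  "0 = Word []"

definition plus_word :: "'a word \<Rightarrow> 'a word \<Rightarrow> 'a word" where
  "v + w = Word (letters v @ letters w)"

instance
  by standard (simp_all add: zero_word_def plus_word_def)

end

type_synonym ('g, 'k) free = "'g word \<Rightarrow>\<^sub>0 'k"

definition gen :: "'g \<Rightarrow> ('g, 'k::field) free" where
  "gen x = Poly_Mapping.single (Word [x]) 1"

definition fscale :: "'k \<Rightarrow> ('g, 'k::field) free \<Rightarrow> ('g, 'k) free" where
  "fscale c f = Poly_Mapping.map ((*) c) f"

text \<open>The free non-unital algebra on \<open>X\<close>: the empty word must not occur.\<close>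

definition free_carr :: "'g set \<Rightarrow> ('g, 'k::field) free set" where
  "free_carr X = {f. \<forall>w\<in>Poly_Mapping.keys f. letters w \<noteq> [] \<and> set (letters w) \<subseteq> X}"

definition free_ideal :: "'g set \<Rightarrow> ('g, 'k::field) free set \<Rightarrow> bool" where
  "free_ideal X I \<longleftrightarrow> I \<subseteq> free_carr X \<and> 0 \<in> I \<and>
     (\<forall>f\<in>I. \<forall>g\<in>I. f + g \<in> I) \<and>
     (\<forall>c. \<forall>f\<in>I. fscale c f \<in> I) \<and>
     (\<forall>f\<in>I. \<forall>g\<in>free_carr X. f * g \<in> I \<and> g * f \<in> I)"

definition gen_ideal :: "'g set \<Rightarrow> ('g, 'k::field) free set \<Rightarrow> ('g, 'k) free set" where
  "gen_ideal X R = \<Inter>{I. free_ideal X I \<and> R \<subseteq> I}"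

definition pres_rel ::
    "'g set \<Rightarrow> ('g, 'k::field) free set \<Rightarrow> (('g, 'k) free \<times> ('g, 'k) free) set" where
  "pres_rel X R = {(f, g). f \<in> free_carr X \<and> g \<in> free_carr X \<and> f - g \<in> gen_ideal X R}"

definition presented ::
    "'g set \<Rightarrow> ('g, 'k::field) free set \<Rightarrow> ('k, ('g, 'k) free set) nu_alg" where
  "presented X R =
    \<lparr> carr = free_carr X // pres_rel X R,
      add = (\<lambda>S T. \<Union>f\<in>S. \<Union>g\<in>T. pres_rel X R `` {f + g}),
      zero = pres_rel X R `` {0},
      mult = (\<lambda>S T. \<Union>f\<in>S. \<Union>g\<in>T. pres_rel X R `` {f * g}),
      scale = (\<lambda>c S. \<Union>f\<in>S. pres_rel X R `` {fscale c f}) \<rparr>"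

lemma lookup_fscale: "Poly_Mapping.lookup (fscale c f) w = c * Poly_Mapping.lookup f w"
  unfolding fscale_def by transfer (simp add: when_def)

lemma fscale_conv_mult: "fscale c f = Poly_Mapping.single 0 c * f"
proof (rule poly_mapping_eqI)
  fix w
  have "Poly_Mapping.lookup (Poly_Mapping.single 0 c * f) w
      = (\<Sum>l. Poly_Mapping.lookup (Poly_Mapping.single 0 c) l *
          (\<Sum>q. Poly_Mapping.lookup f q when w = l + q))"
    by (simp add: times_poly_mapping.rep_eq prod_fun_def)
  also have "\<dots> = (\<Sum>l. (c * (\<Sum>q. Poly_Mapping.lookup f q when w = l + q)) when l = 0)"
    by (rule Sum_any.cong) (simp add: lookup_single when_def)
  also have "\<dots> = c * Poly_Mapping.lookup f w"
    by simp
  finally show "Poly_Mapping.lookup (fscale c f) w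
      = Poly_Mapping.lookup (Poly_Mapping.single 0 c * f) w"
    by (simp add: lookup_fscale)
qed

lemma fscale_mult_left: "fscale c f * g = fscale c (f * g)"
  by (simp add: fscale_conv_mult mult.assoc)

lemma fscale_add: "fscale c (f + g) = fscale c f + fscale c g"
  by (rule poly_mapping_eqI) (simp add: lookup_fscale lookup_add algebra_simps)

lemma fscale_diff: "fscale c (f - g) = fscale c f - fscale c g"
  by (rule poly_mapping_eqI) (simp add: lookup_fscale lookup_minus algebra_simps)

lemma single_0_central:
  fixes f :: "('g, 'k::field) free"
  shows "f * Poly_Mapping.single 0 c = Poly_Mapping.single 0 c * f"
proof (induction f rule: update_induct)
  case const
  show ?case by simp
next
  case (update f a b)
  have "Poly_Mapping.update a b f = f + Poly_Mapping.single a b"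
    using update(1)
    by (intro poly_mapping_eqI)
       (auto simp: lookup_update lookup_add lookup_single when_def in_keys_iff)
  then show ?case
    using update by (simp add: distrib_left distrib_right mult_single mult.commute)
qed

lemma fscale_mult_right: "f * fscale c g = fscale c (f * g)"
  by (metis fscale_conv_mult mult.assoc single_0_central)

lemma free_carr_zero: "0 \<in> free_carr X"
  by (simp add: free_carr_def)

lemma free_carr_add: "f \<in> free_carr X \<Longrightarrow> g \<in> free_carr X \<Longrightarrow> f + g \<in> free_carr X"
  using Poly_Mapping.keys_add[of f g] by (fastforce simp: free_carr_def)

lemma free_carr_fscale: "f \<in> free_carr X \<Longrightarrow> fscale c f \<in> free_carr X"
  by (auto simp: free_carr_def in_keys_iff lookup_fscale)

lemma free_carr_diff: "f \<in> free_carr X \<Longrightarrow> g \<in> free_carr X \<Longrightarrow> f - g \<in> free_carr X"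
  using free_carr_add[of f X "fscale (-1) g"] free_carr_fscale[of g X "-1"]
  by (metis (no_types, lifting) diff_conv_add_uminus fscale_conv_mult mult_minus1
      single_one single_uminus)

lemma free_carr_mult: "f \<in> free_carr X \<Longrightarrow> g \<in> free_carr X \<Longrightarrow> f * g \<in> free_carr X"
  using keys_mult[of f g] by (fastforce simp: free_carr_def plus_word_def)

lemma free_carr_gen: "x \<in> X \<Longrightarrow> gen x \<in> free_carr X"
  by (simp add: free_carr_def gen_def)

lemma free_ideal_free_carr: "free_ideal X (free_carr X)"
  by (auto simp: free_ideal_def free_carr_zero intro: free_carr_add free_carr_fscale free_carr_mult)

lemma free_ideal_gen_ideal:
  assumes "R \<subseteq> free_carr X"
  shows "free_ideal X (gen_ideal X R)"
proof -
  have "gen_ideal X R \<subseteq> free_carr X"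
    unfolding gen_ideal_def using assms free_ideal_free_carr by blast
  then show ?thesis
    unfolding free_ideal_def gen_ideal_def by blast
qed

lemma subset_gen_ideal: "R \<subseteq> gen_ideal X R"
  unfolding gen_ideal_def by blast

locale presentation =
  fixes X :: "'g set" and R :: "('g, 'k::field) free set"
  assumes relators: "R \<subseteq> free_carr X"
begin

lemma ideal_props:
  shows "0 \<in> gen_ideal X R"
    and "f \<in> gen_ideal X R \<Longrightarrow> g \<in> gen_ideal X R \<Longrightarrow> f + g \<in> gen_ideal X R"
    and "f \<in> gen_ideal X R \<Longrightarrow> fscale c f \<in> gen_ideal X R"
    and "f \<in> gen_ideal X R \<Longrightarrow> g \<in> free_carr X \<Longrightarrow> f * g \<in> gen_ideal X R"
    and "f \<in> gen_ideal X R \<Longrightarrow> g \<in> free_carr X \<Longrightarrow> g * f \<in> gen_ideal X R"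
  using free_ideal_gen_ideal[OF relators] by (simp_all add: free_ideal_def)

lemma ideal_uminus: "f \<in> gen_ideal X R \<Longrightarrow> - f \<in> gen_ideal X R"
  using ideal_props(3)[of f "-1"] by (simp add: fscale_conv_mult single_uminus)

lemma equiv_pres_rel: "equiv (free_carr X) (pres_rel X R)"
proof (rule equivI)
  show "pres_rel X R \<subseteq> free_carr X \<times> free_carr X"
    by (auto simp: pres_rel_def)
  show "refl_on (free_carr X) (pres_rel X R)"
    by (auto simp: refl_on_def pres_rel_def ideal_props(1))
  show "sym (pres_rel X R)"
    using ideal_uminus by (force simp: sym_def pres_rel_def)
  show "trans (pres_rel X R)"
    using ideal_props(2) by (fastforce simp: trans_def pres_rel_def)
qed

lemma pres_rel_add:
  "(f, f') \<in> pres_rel X R \<Longrightarrow> (g, g') \<in> pres_rel X R \<Longrightarrow> (f + g, f' + g') \<in> pres_rel X R"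
  using ideal_props(2)[of "f - f'" "g - g'"]
  by (auto simp: pres_rel_def free_carr_add algebra_simps)

lemma pres_rel_mult:
  assumes "(f, f') \<in> pres_rel X R" "(g, g') \<in> pres_rel X R"
  shows "(f * g, f' * g') \<in> pres_rel X R"
proof -
  have "f * g - f' * g' = (f - f') * g + f' * (g - g')"
    by (simp add: algebra_simps)
  then show ?thesis
    using assms
    by (auto simp: pres_rel_def intro: free_carr_mult ideal_props(2) ideal_props(4,5))
qed

lemma pres_rel_fscale: "(f, f') \<in> pres_rel X R \<Longrightarrow> (fscale c f, fscale c f') \<in> pres_rel X R"
  using ideal_props(3)[of "f - f'" c]
  by (auto simp: pres_rel_def free_carr_fscale fscale_diff)

abbreviation cls :: "('g, 'k) free \<Rightarrow> ('g, 'k) free set" where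
  "cls f \<equiv> pres_rel X R `` {f}"

lemma cls_eq_iff:
  "f \<in> free_carr X \<Longrightarrow> g \<in> free_carr X \<Longrightarrow> cls f = cls g \<longleftrightarrow> f - g \<in> gen_ideal X R"
  by (subst eq_equiv_class_iff[OF equiv_pres_rel]) (simp_all add: pres_rel_def)

lemma carr_eq: "carr (presented X R) = cls ` free_carr X"
  by (auto simp: presented_def quotient_def)

lemma zero_cls: "zero (presented X R) = cls 0"
  by (simp add: presented_def)

lemma add_cls:
  assumes "f \<in> free_carr X" "g \<in> free_carr X"
  shows "add (presented X R) (cls f) (cls g) = cls (f + g)"
proof -
  have "congruent2 (pres_rel X R) (pres_rel X R) (\<lambda>f g. cls (f + g))"
    by (rule congruent2I')
       (metis equiv_class_eq[OF equiv_pres_rel] pres_rel_add)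
  from UN_equiv_class2[OF equiv_pres_rel equiv_pres_rel this assms]
  show ?thesis by (simp add: presented_def)
qed

lemma mult_cls:
  assumes "f \<in> free_carr X" "g \<in> free_carr X"
  shows "mult (presented X R) (cls f) (cls g) = cls (f * g)"
proof -
  have "congruent2 (pres_rel X R) (pres_rel X R) (\<lambda>f g. cls (f * g))"
    by (rule congruent2I')
       (metis equiv_class_eq[OF equiv_pres_rel] pres_rel_mult)
  from UN_equiv_class2[OF equiv_pres_rel equiv_pres_rel this assms]
  show ?thesis by (simp add: presented_def)
qed

lemma scale_cls:
  assumes "f \<in> free_carr X"
  shows "scale (presented X R) c (cls f) = cls (fscale c f)"
proof -
  have "congruent (pres_rel X R) (\<lambda>f. cls (fscale c f))"
    by (rule congruentI)
       (metis equiv_class_eq[OF equiv_pres_rel] pres_rel_fscale)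
  from UN_equiv_class[OF equiv_pres_rel this assms]
  show ?thesis by (simp add: presented_def)
qed

lemma nu_algebra_presented: "nu_algebra (presented X R)"
proof -
  note ops = add_cls mult_cls scale_cls zero_cls
    free_carr_zero free_carr_add free_carr_mult free_carr_fscale
  have inv: "\<exists>y\<in>free_carr X. add (presented X R) (cls y) (cls f) = zero (presented X R)"
    if "f \<in> free_carr X" for f
    by (rule bexI[of _ "0 - f"]) (use that in \<open>simp_all add: ops free_carr_diff flip: diff_0\<close>)
  have one: "fscale 1 f = f" and sc: "fscale c (fscale d f) = fscale (c * d) f"
    and sa: "fscale (c + d) f = fscale c f + fscale d f" for c d :: 'k and f :: "('g, 'k) free"
    by (rule poly_mapping_eqI; simp add: lookup_fscale lookup_add algebra_simps)+
  show ?thesis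
    using inv
    by unfold_locales
       (auto simp: carr_eq ops one sc sa fscale_add fscale_mult_left fscale_mult_right
          add.assoc add.commute add.left_commute mult.assoc distrib_left distrib_right)
qed

end

record ('v, 'e) hypergraph =
  verts :: "'v set"
  hedges :: "'e set"
  src :: "'e \<Rightarrow> 'v multiset"
  rng :: "'e \<Rightarrow> 'v multiset"

locale hypergraph =
  fixes H :: "('v, 'e) hypergraph"
  assumes nonempty: "verts H \<noteq> {} \<or> hedges H \<noteq> {}"
    and src: "h \<in> hedges H \<Longrightarrow> src H h \<noteq> {#} \<and> set_mset (src H h) \<subseteq> verts H"
    and rng: "h \<in> hedges H \<Longrightarrow> rng H h \<noteq> {#} \<and> set_mset (rng H h) \<subseteq> verts H"

locale listed_hypergraph = hypergraph H for H :: "('v, 'e) hypergraph" +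
  fixes S R :: "'e \<Rightarrow> 'v list"
  assumes src_listing: "h \<in> hedges H \<Longrightarrow> mset (S h) = src H h"
    and rng_listing: "h \<in> hedges H \<Longrightarrow> mset (R h) = rng H h"

text \<open>
  \<open>Edge h i j\<close> and \<open>Ghost h i j\<close> are the generators usually written $h_{ij}$ and $h_{ij}^*$,
  except that indices start at 0, as they do for list access.
\<close>

datatype ('v, 'e) lpa_gen = Vert 'v | Edge 'e nat nat | Ghost 'e nat nat

definition lpa_gens :: "('v, 'e) hypergraph \<Rightarrow> ('v, 'e) lpa_gen set" where
  "lpa_gens H =
     {Vert v | v. v \<in> verts H} \<union>
     {Edge h i j | h i j. h \<in> hedges H \<and> i < size (src H h) \<and> j < size (rng H h)} \<union>
     {Ghost h i j | h i j. h \<in> hedges H \<and> i < size (src H h) \<and> j < size (rng H h)}"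

abbreviation vert :: "'v \<Rightarrow> (('v, 'e) lpa_gen, 'k::field) free" where
  "vert v \<equiv> gen (Vert v)"

abbreviation edge :: "'e \<Rightarrow> nat \<Rightarrow> nat \<Rightarrow> (('v, 'e) lpa_gen, 'k::field) free" where
  "edge h i j \<equiv> gen (Edge h i j)"

abbreviation ghost :: "'e \<Rightarrow> nat \<Rightarrow> nat \<Rightarrow> (('v, 'e) lpa_gen, 'k::field) free" where
  "ghost h i j \<equiv> gen (Ghost h i j)"

text \<open>A relation $a = b$ is represented by $a - b$.\<close>

definition lpa_rels :: "('v, 'e) hypergraph \<Rightarrow> ('e \<Rightarrow> 'v list) \<Rightarrow> ('e \<Rightarrow> 'v list) \<Rightarrow>
    (('v, 'e) lpa_gen, 'k::field) free set" where
  "lpa_rels H S R =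
     {vert u * vert v - (if u = v then vert u else 0) | u v. u \<in> verts H \<and> v \<in> verts H} \<union>
     (\<Union>h\<in>hedges H. \<Union>i\<in>{..<size (src H h)}. \<Union>j\<in>{..<size (rng H h)}.
        {vert (S h ! i) * edge h i j - edge h i j,
         edge h i j * vert (R h ! j) - edge h i j,
         vert (R h ! j) * ghost h i j - ghost h i j,
         ghost h i j * vert (S h ! i) - ghost h i j}) \<union>
     {(\<Sum>k<size (rng H h). edge h i k * ghost h j k) - (if i = j then vert (S h ! i) else 0)
       | h i j. h \<in> hedges H \<and> i < size (src H h) \<and> j < size (src H h)} \<union>
     {(\<Sum>k<size (src H h). ghost h k i * edge h k j) - (if i = j then vert (R h ! i) else 0)
       | h i j. h \<in> hedges H \<and> i < size (rng H h) \<and> j < size (rng H h)}"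

definition leavitt_path_algebra ::
    "('v, 'e) hypergraph \<Rightarrow> ('e \<Rightarrow> 'v list) \<Rightarrow> ('e \<Rightarrow> 'v list) \<Rightarrow>
     ('k::field, (('v, 'e) lpa_gen, 'k) free set) nu_alg" where
  "leavitt_path_algebra H S R = presented (lpa_gens H) (lpa_rels H S R)"

lemma free_carr_sum: "(\<And>k. k \<in> B \<Longrightarrow> f k \<in> free_carr X) \<Longrightarrow> sum f B \<in> free_carr X"
  by (induction B rule: infinite_finite_induct) (auto simp: free_carr_zero intro: free_carr_add)

context listed_hypergraph
begin

lemma lpa_rels_subset: "lpa_rels H S R \<subseteq> free_carr (lpa_gens H)"
proof -
  have S: "S h ! i \<in> verts H" if "h \<in> hedges H" "i < size (src H h)" for h i
    using that src[of h] src_listing[of h] by (metis nth_mem set_mset_mset size_mset subsetD)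
  have R: "R h ! i \<in> verts H" if "h \<in> hedges H" "i < size (rng H h)" for h i
    using that rng[of h] rng_listing[of h] by (metis nth_mem set_mset_mset size_mset subsetD)
  show ?thesis
    unfolding lpa_rels_def
    by (auto simp: lpa_gens_def S R
        intro!: free_carr_diff free_carr_mult free_carr_gen free_carr_sum free_carr_zero)
qed

sublocale lpa: presentation "lpa_gens H" "lpa_rels H S R"
  by unfold_locales (rule lpa_rels_subset)

lemma nu_algebra_leavitt_path_algebra: "nu_algebra (leavitt_path_algebra H S R)"
  unfolding leavitt_path_algebra_def by (rule lpa.nu_algebra_presented)

end

end

theory Submission
  imports Defs "HOL-Library.Sublist"
begin

text \<open>
  The two kinds of generators of a hyperedge \<open>h\<close> form mutually inverse matrices of sizes
  $|s(h)| \times |r(h)|$ and $|r(h)| \times |s(h)|$. Solving the relations for the products of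
  entries whose inner index is the first one gives a confluent rewriting system. Instead of
  checking confluence we let the algebra act on the span of the irreducible words, where
  prepending a letter needs at most one rewriting step; applying an element to a vertex recovers
  its normal form.

  In particular vertices are nonzero, and two distinct vertices, or a hyperedge with exactly one
  of $|s(h)|$, $|r(h)|$ equal to 1, give zero divisors. For the converse let the degree of a word
  count its letters from hyperedges with $|s(h)|, |r(h)| \ge 2$; the other hyperedges generate a
  free group. In top degree a product of two elements is concatenation, except that where two
  opposite letters that count meet, the tensor product $K^n \otimes K^n$ of the inner index spaces
  is taken modulo $\sum_k e_k \otimes e_k$. As $n \ge 2$, this tensor is not of rank one, so the
  product of two nonzero vectors stays nonzero. Together with the unique product property of free
  groups this yields a basis word of the product to which exactly one pair of words contributes.
\<close>

section \<open>Unique products in free groups\<close>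

text \<open>Normal words therefore end in a vertex, and the algebra acts on them from the left, so
  that a new letter meets only the first letter of a word.

  Comparing leading words is not enough: rewriting \<open>h_{i1} h_{1j}^*\<close> yields terms
  \<open>h_{ik} h_{kj}^*\<close> of the same degree, so several pairs of words of top degree may
  contribute to one word and cancel. Hence the search for a word reached from a single pair; its
  coefficient is a product of nonzero scalars, whatever the other coefficients are.

  Letters of 1 by 1 hyperedges must not count for the degree, because they are invertible modulo the
  relations and their cancellation would lower it. What they contribute between the last counted
  letter of one factor and the first counted letter of the other is an element of a free group ring,
  and there unique products enter. The tensor argument is for the case that the group element in
  between is trivial, so that two counted letters become neighbours.\<close>

text \<open>
  Magnus' embedding: the free group acts on noncommutative integer power series, given by their
  coefficients at words, a generator \<open>a\<close> acting by multiplication with $1 + X_a$ from the left.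
\<close>

definition mag :: "'a \<Rightarrow> ('a list \<Rightarrow> int) \<Rightarrow> 'a list \<Rightarrow> int" where
  "mag a f w = f w + (case w of [] \<Rightarrow> 0 | b # w' \<Rightarrow> if b = a then f w' else 0)"

text \<open>Multiplication by the inverse of \<open>1 + X_a\<close>: the equation
  \<open>g + X_a g = f\<close> solved for the coefficients of \<open>g\<close>, shortest words
  first.\<close>

fun mag_inv :: "'a \<Rightarrow> ('a list \<Rightarrow> int) \<Rightarrow> 'a list \<Rightarrow> int" where
  "mag_inv a f [] = f []"
| "mag_inv a f (b # w) = f (b # w) - (if b = a then mag_inv a f w else 0)"

lemma mag_simps [simp]:
  "mag a f [] = f []"
  "mag a f (b # w) = f (b # w) + (if b = a then f w else 0)"
  by (simp_all add: mag_def)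

lemma mag_mag_inv: "mag a (mag_inv a f) = f"
proof
  show "mag a (mag_inv a f) w = f w" for w
    by (cases w) simp_all
qed

lemma mag_inv_mag: "mag_inv a (mag a f) = f"
proof
  show "mag_inv a (mag a f) w = f w" for w
    by (induction w) simp_all
qed

text \<open>A pair \<open>(a, True)\<close> stands for the generator \<open>a\<close> and
  \<open>(a, False)\<close> for its inverse.\<close>

definition mag_letter :: "'a \<times> bool \<Rightarrow> ('a list \<Rightarrow> int) \<Rightarrow> 'a list \<Rightarrow> int" where
  "mag_letter x = (if snd x then mag (fst x) else mag_inv (fst x))"

definition flip :: "'a \<times> bool \<Rightarrow> 'a \<times> bool" where
  "flip x = (fst x, \<not> snd x)"

definition ginv :: "('a \<times> bool) list \<Rightarrow> ('a \<times> bool) list" where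
  "ginv x = rev (map flip x)"

text \<open>No free group is constructed: equality of group elements is equality of the operators
  \<open>ev x\<close>.\<close>

definition ev :: "('a \<times> bool) list \<Rightarrow> ('a list \<Rightarrow> int) \<Rightarrow> 'a list \<Rightarrow> int" where
  "ev x = foldr mag_letter x"

definition reduced :: "('a \<times> bool) list \<Rightarrow> bool" where
  "reduced = successively (\<lambda>x y. y \<noteq> flip x)"

lemma flip_flip [simp]: "flip (flip x) = x"
  by (simp add: flip_def)

lemma ginv_simps [simp]:
  "ginv [] = []" "ginv (x # xs) = ginv xs @ [flip x]" "ginv (xs @ ys) = ginv ys @ ginv xs"
  by (simp_all add: ginv_def)

lemma ev_Nil [simp]: "ev [] f = f"
  by (simp add: ev_def)

lemma ev_Cons: "ev (x # xs) f = mag_letter x (ev xs f)"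
  by (simp add: ev_def)

lemma ev_append: "ev (x @ y) f = ev x (ev y f)"
  by (simp add: ev_def)

lemma mag_letter_flip [simp]:
  "mag_letter x (mag_letter (flip x) f) = f" "mag_letter (flip x) (mag_letter x f) = f"
  by (auto simp: mag_letter_def flip_def mag_mag_inv mag_inv_mag)

lemma ev_ginv [simp]: "ev x (ev (ginv x) f) = f" "ev (ginv x) (ev x f) = f"
  by (induction x arbitrary: f) (simp_all add: ev_Cons ev_append)

lemma ev_cancel: "ev ((x @ u) @ ginv u @ y) = ev (x @ y)"
  by (rule ext) (simp add: ev_append)

section \<open>Coefficients at words without adjacent repetitions\<close>

definition stutter_free :: "'a list \<Rightarrow> bool" where
  "stutter_free = successively (\<noteq>)"

text \<open>The powers \<open>X_a^n\<close> with n \<ge> 2 in the inverse of \<open>1 + X_a\<close>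
  reach only words beginning with \<open>a a\<close>. At all other words the inverse acts as
  \<open>1 - X_a\<close>.\<close>

lemma mag_letter_stutter_free:
  assumes "stutter_free (b # w)"
  shows "mag_letter x f (b # w) =
    f (b # w) + (if b = fst x then (if snd x then f w else - f w) else 0)"
proof -
  have "mag_inv (fst x) f w = f w" if "b = fst x"
    using assms that by (cases w) (auto simp: stutter_free_def)
  then show ?thesis
    by (simp add: mag_letter_def)
qed

abbreviation one_ser :: "'a list \<Rightarrow> int" where
  "one_ser \<equiv> \<lambda>w. if w = [] then 1 else 0"

definition runs :: "('a \<times> bool) list \<Rightarrow> 'a list" where
  "runs x = remdups_adj (map fst x)"

lemma stutter_free_remdups_adj: "stutter_free (remdups_adj xs)"
  unfolding stutter_free_def by (induction xs rule: remdups_adj.induct) (auto simp: successively_Cons)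

lemma stutter_free_tl: "stutter_free (b # w) \<Longrightarrow> stutter_free w"
  by (cases w) (auto simp: stutter_free_def)

text \<open>Each letter either keeps a coefficient or prepends its own generator, and consecutive
  letters with the same generator supply at most one letter of a word without repetitions. In
  particular the coefficient vanishes at such words longer than \<open>runs x\<close>.\<close>

lemma ev_support:
  assumes "stutter_free u" "ev x one_ser u \<noteq> 0"
  shows "subseq u (runs x)"
  using assms
proof (induction x arbitrary: u)
  case Nil
  then show ?case by (simp split: if_splits)
next
  case (Cons x xs)
  have mono: "subseq (runs xs) (runs (x # xs))"
    by (cases xs) (auto simp: runs_def)
  show ?case
  proof (cases u)
    case u: (Cons b w)
    have "ev xs one_ser u \<noteq> 0 \<or> b = fst x \<and> ev xs one_ser w \<noteq> 0"
      using Cons.prems by (auto simp: u ev_Cons mag_letter_stutter_free split: if_splits)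
    then show ?thesis
    proof
      assume "ev xs one_ser u \<noteq> 0"
      then show ?thesis
        using Cons.IH[OF Cons.prems(1)] mono by (blast intro: subseq_order.order_trans)
    next
      assume *: "b = fst x \<and> ev xs one_ser w \<noteq> 0"
      then have sub: "subseq w (runs xs)"
        using Cons.IH[OF stutter_free_tl[OF Cons.prems(1)[unfolded u]]] by simp
      show ?thesis
      proof (cases "xs \<noteq> [] \<and> fst (hd xs) = fst x")
        case True
        then obtain y ys where xs: "xs = y # ys" "fst y = fst x"
          by (cases xs) auto
        obtain c where c: "runs xs = fst x # c"
          using xs by (cases "runs xs") (auto simp: runs_def remdups_adj_Cons split: list.splits if_splits)
        \<comment> \<open>The new letter joins the first run. Since \<open>w\<close> does not begin
          with its generator, \<open>w\<close> already embeds behind the first entry.\<close>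
        have "runs (x # xs) = runs xs"
          using xs by (simp add: runs_def)
        moreover have "subseq w c"
        proof (cases w)
          case (Cons b' w')
          then have "b' \<noteq> fst x"
            using Cons.prems(1) u * by (auto simp: stutter_free_def)
          then show ?thesis
            using sub by (simp add: Cons c)
        qed simp
        ultimately show ?thesis
          using u * c by auto
      next
        case False
        then have "runs (x # xs) = fst x # runs xs"
          by (cases xs) (auto simp: runs_def)
        then show ?thesis
          using u * sub by auto
      qed
    qed
  qed simp
qed

text \<open>
  For $x = a_1^{n_1} \cdots a_k^{n_k}$ the coefficient at $a_1 \cdots a_k$ is $n_1 \cdots n_k$; the
  induction on letters needs its sign and size relative to the coefficient at $a_2 \cdots a_k$.
\<close>

lemma ev_runs_aux:
  assumes "reduced (x # xs)"
  shows "\<exists>n\<ge>1. ev (x # xs) one_ser (tl (runs (x # xs))) \<noteq> 0 \<and>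
    ev (x # xs) one_ser (runs (x # xs)) =
      (if snd x then n else - n) * ev (x # xs) one_ser (tl (runs (x # xs)))"
  using assms
proof (induction xs arbitrary: x)
  case Nil
  show ?case
    by (rule exI[of _ 1]) (simp add: runs_def ev_Cons mag_letter_def)
next
  case (Cons y ys)
  let ?f = "ev (y # ys) one_ser"
  obtain n where n: "n \<ge> 1" "?f (tl (runs (y # ys))) \<noteq> 0"
    "?f (runs (y # ys)) = (if snd y then n else - n) * ?f (tl (runs (y # ys)))"
    using Cons.IH[of y] Cons.prems by (auto simp del: split_paired_All simp: reduced_def)
  obtain c where c: "runs (y # ys) = fst y # c"
    by (cases "runs (y # ys)") (auto simp: runs_def remdups_adj_Cons split: list.splits if_splits)
  have sf: "stutter_free (runs zs)" for zs :: "('a \<times> bool) list"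
    by (simp add: runs_def stutter_free_remdups_adj)
  note sfc = sf[of "y # ys", unfolded c]
  show ?case
  proof (cases "fst x = fst y")
    case True
    then have s: "snd x = snd y"
      using Cons.prems by (auto simp: reduced_def flip_def prod_eq_iff)
    have r: "runs (x # y # ys) = fst y # c"
      using True c by (simp add: runs_def)
    have c0: "ev (x # y # ys) one_ser c = ?f c"
    proof (cases c)
      case Nil
      then show ?thesis
        by (simp add: ev_Cons[of x] mag_letter_def)
    next
      case (Cons b w)
      then have "stutter_free (b # w)" "b \<noteq> fst x"
        using sfc True by (auto simp: stutter_free_def)
      then show ?thesis
        using Cons by (simp add: ev_Cons[of x] mag_letter_stutter_free)
    qed
    have c1: "ev (x # y # ys) one_ser (fst y # c) = ?f (fst y # c) + (if snd x then ?f c else - ?f c)"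
      using True by (simp add: ev_Cons[of x] mag_letter_stutter_free[OF sfc])
    \<comment> \<open>The letter extends the first run with the same sign: the factor
      \<open>n\<close> grows by one, while the coefficient at the tail \<open>c\<close>
      stays.\<close>
    show ?thesis
      by (rule exI[of _ "n + 1"])
        (use n c s in \<open>auto simp: r c0 c1 algebra_simps\<close>)
  next
    case False
    have r: "runs (x # y # ys) = fst x # fst y # c"
      using False c by (simp add: runs_def)
    note sfx = sf[of "x # y # ys", unfolded r]
    \<comment> \<open>This word is longer than \<open>runs (y # ys)\<close>, so its coefficient in
      the new series comes from prepending \<open>fst x\<close> alone.\<close>
    have z: "?f (fst x # fst y # c) = 0"
      using ev_support[OF sfx, of "y # ys"] list_emb_length[of "(=)" "fst x # fst y # c" "fst y # c"]
      by (auto simp: c)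
    have nz: "?f (fst y # c) \<noteq> 0"
      using n c by (auto split: if_splits)
    have c0: "ev (x # y # ys) one_ser (fst y # c) = ?f (fst y # c)"
      using False by (simp add: ev_Cons[of x] mag_letter_stutter_free[OF sfc])
    have c1: "ev (x # y # ys) one_ser (fst x # fst y # c) =
        (if snd x then ?f (fst y # c) else - ?f (fst y # c))"
      by (simp add: ev_Cons[of x] mag_letter_stutter_free[OF sfx] z)
    show ?thesis
      by (rule exI[of _ 1]) (use nz in \<open>simp add: r c0 c1\<close>)
  qed
qed

lemma ev_one_ser_eq_one:
  assumes "reduced x" "ev x one_ser = one_ser"
  shows "x = []"
proof (cases x)
  case (Cons y ys)
  obtain n where "n \<ge> 1" "ev x one_ser (tl (runs x)) \<noteq> 0"
    "ev x one_ser (runs x) = (if snd y then n else - n) * ev x one_ser (tl (runs x))"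
    using ev_runs_aux[of y ys] assms(1) unfolding Cons by auto
  then have "ev x one_ser (runs x) \<noteq> 0"
    by auto
  then show ?thesis
    using assms(2) by (auto simp: runs_def split: if_splits)
qed

lemma reduced_ginv: "reduced (ginv x) \<longleftrightarrow> reduced x"
proof -
  have "reduced (ginv x) \<longleftrightarrow> successively (\<lambda>a b. flip a \<noteq> b) x"
    unfolding reduced_def ginv_def successively_rev successively_map
    by (simp add: flip_def)
  then show ?thesis
    by (simp add: reduced_def eq_commute)
qed

lemma reduced_ginv_append:
  assumes "reduced x" "reduced y" "x = [] \<or> y = [] \<or> hd x \<noteq> hd y"
  shows "reduced (ginv x @ y)"
proof (cases "x = [] \<or> y = []")
  case False
  then have "last (ginv x) = flip (hd x)"
    by (cases x) simp_all
  then show ?thesis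
    using assms False reduced_ginv[of x] by (auto simp: reduced_def successively_append_iff)
qed (use assms reduced_ginv[of x] in auto)

text \<open>Common first letters are stripped. Once the first letters differ,
  \<open>ginv x @ y\<close> is reduced and fixes \<open>one_ser\<close>, which is impossible for a
  nonempty word.\<close>

lemma ev_one_ser_inj:
  assumes "reduced x" "reduced y" "ev x one_ser = ev y one_ser"
  shows "x = y"
  using assms
proof (induction x arbitrary: y)
  case Nil
  then show ?case
    using ev_one_ser_eq_one[of y] by simp
next
  case (Cons a x)
  show ?case
  proof (cases "y \<noteq> [] \<and> hd y = a")
    case True
    then obtain y' where y: "y = a # y'"
      by (cases y) auto
    have "ev x one_ser = ev y' one_ser"
      using Cons.prems(3) unfolding y ev_Cons by (metis mag_letter_flip(2))
    then show ?thesis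
      using Cons.IH[of y'] Cons.prems y by (auto simp: reduced_def successively_Cons)
  next
    case False
    then have "reduced (ginv (a # x) @ y)"
      using Cons.prems by (intro reduced_ginv_append) auto
    moreover have "ev (ginv (a # x) @ y) one_ser = one_ser"
      using Cons.prems(3) by (metis ev_append ev_ginv(2))
    ultimately show ?thesis
      using ev_one_ser_eq_one by fastforce
  qed
qed

section \<open>A left-invariant order on power series\<close>

definition ser_less :: "('a \<times> 'a) set \<Rightarrow> ('a list \<Rightarrow> int) \<Rightarrow> ('a list \<Rightarrow> int) \<Rightarrow> bool" where
  "ser_less r f g \<longleftrightarrow> (\<exists>w. f w < g w \<and> (\<forall>w'. (w', w) \<in> lenlex r \<longrightarrow> f w' = g w'))"

lemma lenlex_shorter: "length u < length w \<Longrightarrow> (u, w) \<in> lenlex r"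
  by (simp add: lenlex_conv)

text \<open>\<open>mag_letter x f w\<close> is \<open>f w\<close> plus an integer combination of
  coefficients at proper suffixes of \<open>w\<close>. These are shorter, hence smaller in
  \<open>lenlex\<close>, so the first place of difference and its sign survive.\<close>

lemma ser_less_mag_letter:
  assumes "trans r" "ser_less r f g"
  shows "ser_less r (mag_letter x f) (mag_letter x g)"
proof -
  obtain w where w: "f w < g w" "\<And>u. (u, w) \<in> lenlex r \<Longrightarrow> f u = g u"
    using assms(2) by (auto simp: ser_less_def)
  have tr: "(u, w) \<in> lenlex r" if "(b # u, w) \<in> lenlex r" for b u
    by (rule transD[OF lenlex_transI[OF assms(1)] lenlex_shorter that]) simp
  have inv: "mag_inv a f u = mag_inv a g u" if "(u, w) \<in> lenlex r" for a u
    using that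
  proof (induction u)
    case (Cons b u)
    then show ?case
      using w(2)[OF Cons.prems] Cons.IH[OF tr[OF Cons.prems]] by simp
  qed (simp add: w(2))
  have mg: "mag a f u = mag a g u" if "(u, w) \<in> lenlex r" for a u
  proof (cases u)
    case (Cons b u')
    then show ?thesis
      using w(2)[OF that] w(2)[OF tr[OF that[unfolded Cons]]] by simp
  qed (use w(2)[OF that] in simp)
  have "mag_inv a f w < mag_inv a g w" and "mag a f w < mag a g w" for a
  proof -
    have "mag_inv a f w < mag_inv a g w \<and> mag a f w < mag a g w"
    proof (cases w)
      case (Cons b u)
      then have u: "(u, w) \<in> lenlex r"
        by (simp add: lenlex_shorter)
      show ?thesis
        using w(1) w(2)[OF u] inv[OF u, of a] by (cases "b = a") (simp_all add: Cons)
    qed (use w(1) in simp)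
    then show "mag_inv a f w < mag_inv a g w" and "mag a f w < mag a g w"
      by simp_all
  qed
  then show ?thesis
    unfolding ser_less_def mag_letter_def using inv mg by (intro exI[of _ w]) auto
qed

lemma ser_less_ev: "trans r \<Longrightarrow> ser_less r f g \<Longrightarrow> ser_less r (ev x f) (ev x g)"
  by (induction x) (simp_all add: ev_Cons ser_less_mag_letter)

lemma ser_less_irrefl: "\<not> ser_less r f f"
  by (simp add: ser_less_def)

lemma ser_less_trans:
  assumes "trans r" "total r" "ser_less r f g" "ser_less r g h"
  shows "ser_less r f h"
proof -
  obtain u where u: "f u < g u" "\<And>w. (w, u) \<in> lenlex r \<Longrightarrow> f w = g w"
    using assms(3) by (auto simp: ser_less_def)
  obtain v where v: "g v < h v" "\<And>w. (w, v) \<in> lenlex r \<Longrightarrow> g w = h w"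
    using assms(4) by (auto simp: ser_less_def)
  have tr: "trans (lenlex r)"
    by (rule lenlex_transI[OF assms(1)])
  consider "(u, v) \<in> lenlex r" | "u = v" | "(v, u) \<in> lenlex r"
    using total_lenlex[OF assms(2)] by (auto simp: total_on_def)
  then show ?thesis
  proof cases
    case 1
    then show ?thesis
      unfolding ser_less_def using u v transD[OF tr] by (intro exI[of _ u]) metis
  next
    case 2
    then show ?thesis
      unfolding ser_less_def using u v by (intro exI[of _ u]) auto
  next
    case 3
    then show ?thesis
      unfolding ser_less_def using u v transD[OF tr] by (intro exI[of _ v]) metis
  qed
qed

lemma ser_less_total:
  assumes "wf r" "total r" "f \<noteq> g"
  shows "ser_less r f g \<or> ser_less r g f"
proof -
  obtain x where "x \<in> {w. f w \<noteq> g w}"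
    using assms(3) by auto
  then obtain w where "f w \<noteq> g w" "\<And>u. (u, w) \<in> lenlex r \<Longrightarrow> f u = g u"
    by (rule wfE_min[OF wf_lenlex[OF assms(1)]]) auto
  then show ?thesis
    unfolding ser_less_def by (metis linorder_neqE)
qed

text \<open>
  Series are ordered by the sign of the first coefficient of their difference, which the action
  preserves. Now take the largest \<open>b\<close>, then the largest \<open>a b\<close>.
\<close>

lemma free_group_unique_product:
  assumes "finite A" "A \<noteq> {}" "finite B" "B \<noteq> {}"
    and red: "\<And>x. x \<in> A \<union> B \<Longrightarrow> reduced x"
  obtains a b where "a \<in> A" "b \<in> B"
    "\<And>a' b'. a' \<in> A \<Longrightarrow> b' \<in> B \<Longrightarrow> ev (a' @ b') = ev (a @ b) \<Longrightarrow> a' = a \<and> b' = b"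
proof -
  \<comment> \<open>The alphabet may be infinite. A well-order makes \<open>lenlex\<close>
    well-founded, so two different series have a first difference.\<close>
  obtain r0 :: "('a \<times> 'a) set" where "well_order_on UNIV r0"
    using well_order_on by blast
  then obtain r :: "('a \<times> 'a) set" where r: "wf r" "trans r" "total r"
    by (intro that[of "r0 - Id"])
      (auto simp: well_order_on_def linear_order_on_def partial_order_on_def preorder_on_def
        intro: trans_diff_Id)
  have max: "\<exists>m\<in>C. \<forall>c\<in>C. c = m \<or> ser_less r (\<phi> c) (\<phi> m) \<or> \<phi> c = \<phi> m"
    if "finite C" "C \<noteq> {}" for C and \<phi> :: "_ \<Rightarrow> 'a list \<Rightarrow> int"
  proof -
    have "\<exists>m\<in>C. \<forall>x\<in>C. x \<noteq> m \<longrightarrow> \<not> ser_less r (\<phi> m) (\<phi> x)"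
      by (rule Finite_Set.bex_max_element[OF that(1) _ _ that(2)])
        (auto simp: asymp_on_def transp_on_def ser_less_irrefl
          dest: ser_less_trans[OF r(2,3)])
    then show ?thesis
      using ser_less_total[OF r(1,3)] by metis
  qed
  obtain b where b: "b \<in> B"
    "\<And>b'. b' \<in> B \<Longrightarrow> b' = b \<or> ser_less r (ev b' one_ser) (ev b one_ser)"
    using max[OF assms(3,4), of "\<lambda>x. ev x one_ser"] ev_one_ser_inj red by (metis UnI2)
  \<comment> \<open>Monotonicity is at hand for left factors only, so \<open>a\<close> is chosen
    after \<open>b\<close>: then \<open>a' b' < a' b \<le> a b\<close> whenever \<open>b'\<close>
    differs from \<open>b\<close>. Ties among the \<open>a'\<close> are settled at the end by
    cancelling \<open>b\<close>.\<close>
  obtain a where a: "a \<in> A" "\<And>a'. a' \<in> A \<Longrightarrow> a' = a \<or>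
      ser_less r (ev (a' @ b) one_ser) (ev (a @ b) one_ser) \<or> ev (a' @ b) one_ser = ev (a @ b) one_ser"
    using max[OF assms(1,2), of "\<lambda>x. ev (x @ b) one_ser"] by metis
  show thesis
  proof (rule that[OF a(1) b(1)])
    fix a' b'
    assume *: "a' \<in> A" "b' \<in> B" and eq: "ev (a' @ b') = ev (a @ b)"
    have "b' = b"
    proof (rule ccontr)
      assume "b' \<noteq> b"
      then have "ser_less r (ev (a' @ b') one_ser) (ev (a' @ b) one_ser)"
        using b * ser_less_ev[OF r(2)] by (metis ev_append)
      then have less: "ser_less r (ev (a @ b) one_ser) (ev (a' @ b) one_ser)"
        by (simp add: eq)
      show False
        using a(2)[OF *(1)]
      proof (elim disjE)
        assume "a' = a"
        then show False
          using less by (simp add: ser_less_irrefl)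
      next
        assume "ser_less r (ev (a' @ b) one_ser) (ev (a @ b) one_ser)"
        from ser_less_trans[OF r(2,3) less this] show False
          by (simp add: ser_less_irrefl)
      next
        assume "ev (a' @ b) one_ser = ev (a @ b) one_ser"
        then show False
          using less by (simp add: ser_less_irrefl)
      qed
    qed
    moreover have "ev a' = ev a"
    proof
      fix f
      show "ev a' f = ev a f"
        using fun_cong[OF eq, of "ev (ginv b) f"] \<open>b' = b\<close> by (simp add: ev_append)
    qed
    ultimately show "a' = a \<and> b' = b"
      using ev_one_ser_inj[of a' a] red * a(1) by simp
  qed
qed

text \<open>Separates the cancelling part \<open>u\<close> from a junction that does not cancel. In
  the algebra the letters of \<open>u\<close> disappear in the same way.\<close>

lemma reduced_product:
  assumes "reduced a" "reduced b"
  obtains a' u b' where "a = a' @ u" "b = ginv u @ b'" "reduced (a' @ b')"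
  using assms
proof (induction a arbitrary: b thesis rule: rev_induct)
  case Nil
  then show ?case
    by (metis append_Nil ginv_simps(1))
next
  case (snoc x a)
  show ?case
  proof (cases "b \<noteq> [] \<and> hd b = flip x")
    case True
    then obtain b1 where b: "b = flip x # b1"
      by (cases b) auto
    have "reduced a" "reduced b1"
      using snoc.prems b by (auto simp: reduced_def successively_append_iff successively_Cons)
    then obtain a' u b' where "a = a' @ u" "b1 = ginv u @ b'" "reduced (a' @ b')"
      using snoc.IH by metis
    then show ?thesis
      using snoc.prems(1)[of a' "u @ [x]" b'] b by simp
  next
    case False
    then have "reduced ((a @ [x]) @ b)"
      using snoc.prems
      by (cases b) (auto simp: reduced_def successively_append_iff successively_Cons)
    then show ?thesis
      using snoc.prems(1)[of "a @ [x]" "[]" b] by simp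
  qed
qed

section \<open>Linear maps on free algebras\<close>

abbreviation wd :: "'g list \<Rightarrow> ('g, 'k::field) free" where
  "wd w \<equiv> Poly_Mapping.single (Word w) 1"

definition linear_map :: "(('g, 'k::field) free \<Rightarrow> ('h, 'k) free) \<Rightarrow> bool" where
  "linear_map T \<longleftrightarrow> (\<forall>f g. T (f + g) = T f + T g) \<and> (\<forall>c f. T (fscale c f) = fscale c (T f))"

lemma fscale_simps [simp]:
  "fscale c 0 = 0" "fscale 0 f = 0" "fscale 1 f = f"
  "fscale c (fscale d f) = fscale (c * d) f"
  "fscale c (Poly_Mapping.single w d) = Poly_Mapping.single w (c * d)"
  by (rule poly_mapping_eqI; simp add: lookup_fscale lookup_single when_def)+

lemma fscale_add_left: "fscale (c + d) f = fscale c f + fscale d f"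
  by (rule poly_mapping_eqI) (simp add: lookup_fscale lookup_add algebra_simps)

lemma fscale_uminus_one: "fscale (- 1) f = - f"
  by (rule poly_mapping_eqI) (simp add: lookup_fscale)

lemma fscale_sum: "fscale c (sum f A) = (\<Sum>x\<in>A. fscale c (f x))"
  by (induction A rule: infinite_finite_induct) (simp_all add: fscale_add)

lemma linear_map_simps:
  assumes "linear_map T"
  shows "T (f + g) = T f + T g" "T (fscale c f) = fscale c (T f)" "T 0 = 0" "T (f - g) = T f - T g"
    "T (sum u A) = (\<Sum>x\<in>A. T (u x))" "T (- f) = - T f"
proof -
  show add: "T (f + g) = T f + T g" and sc: "T (fscale c f) = fscale c (T f)" for f g c
    using assms by (auto simp: linear_map_def)
  show z: "T 0 = 0"
    using sc[of 0 0] by simp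
  show neg: "T (- f) = - T f" for f
    using sc[of "- 1" f] by (simp add: fscale_uminus_one)
  show "T (f - g) = T f - T g"
    using add[of f "- g"] by (simp add: neg)
  show "T (sum u A) = (\<Sum>x\<in>A. T (u x))"
    by (induction A rule: infinite_finite_induct) (simp_all add: add z)
qed

lemma free_expand:
  "(\<Sum>w\<in>Poly_Mapping.keys f. fscale (Poly_Mapping.lookup f w) (wd (letters w))) = f"
proof (rule poly_mapping_eqI)
  fix u
  show "Poly_Mapping.lookup
      (\<Sum>w\<in>Poly_Mapping.keys f. fscale (Poly_Mapping.lookup f w) (wd (letters w))) u =
    Poly_Mapping.lookup f u"
    by (simp add: lookup_sum lookup_single when_def in_keys_iff)
qed

lemma linear_map_expand:
  assumes "linear_map T"
  shows "T f = (\<Sum>w\<in>Poly_Mapping.keys f. fscale (Poly_Mapping.lookup f w) (T (wd (letters w))))"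
proof -
  have "T f = T (\<Sum>w\<in>Poly_Mapping.keys f. fscale (Poly_Mapping.lookup f w) (wd (letters w)))"
    by (simp only: free_expand)
  then show ?thesis
    by (simp only: linear_map_simps[OF assms])
qed

lemma linear_map_eqI:
  assumes "linear_map T" "linear_map U"
    "\<And>w. w \<in> Poly_Mapping.keys f \<Longrightarrow> T (wd (letters w)) = U (wd (letters w))"
  shows "T f = U f"
  using assms(3) by (simp add: linear_map_expand[OF assms(1), of f] linear_map_expand[OF assms(2), of f])

lemma linear_map_comp: "linear_map T \<Longrightarrow> linear_map U \<Longrightarrow> linear_map (\<lambda>f. T (U f))"
  and linear_map_diff: "linear_map T \<Longrightarrow> linear_map U \<Longrightarrow> linear_map (\<lambda>f. T f - U f)"
  and linear_map_zero: "linear_map (\<lambda>f. 0)"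
  and linear_map_id: "linear_map (\<lambda>f. f)"
  and linear_map_times_right: "linear_map (\<lambda>f. f * g)"
  and linear_map_times_left: "linear_map (\<lambda>f. g * f)"
  by (simp_all add: linear_map_def fscale_diff fscale_mult_left fscale_mult_right algebra_simps)

definition linear_ext :: "('g list \<Rightarrow> ('h, 'k::field) free) \<Rightarrow> ('g, 'k) free \<Rightarrow> ('h, 'k) free" where
  "linear_ext \<phi> f = (\<Sum>w\<in>Poly_Mapping.keys f. fscale (Poly_Mapping.lookup f w) (\<phi> (letters w)))"

lemma linear_ext_superset:
  assumes "finite A" "Poly_Mapping.keys f \<subseteq> A"
  shows "linear_ext \<phi> f = (\<Sum>w\<in>A. fscale (Poly_Mapping.lookup f w) (\<phi> (letters w)))"
  unfolding linear_ext_def using assms by (intro sum.mono_neutral_left) (auto simp: in_keys_iff)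

lemma linear_map_linear_ext: "linear_map (linear_ext \<phi>)"
  unfolding linear_map_def
proof (intro conjI allI)
  fix f g :: "('a, 'b) free"
  let ?A = "Poly_Mapping.keys f \<union> Poly_Mapping.keys g"
  have "finite ?A" "Poly_Mapping.keys (f + g) \<subseteq> ?A"
    using Poly_Mapping.keys_add[of f g] by auto
  then show "linear_ext \<phi> (f + g) = linear_ext \<phi> f + linear_ext \<phi> g"
    by (simp add: linear_ext_superset[of ?A] lookup_add fscale_add_left sum.distrib)
next
  fix c and f :: "('a, 'b) free"
  have "Poly_Mapping.keys (fscale c f) \<subseteq> Poly_Mapping.keys f"
    by (auto simp: in_keys_iff lookup_fscale)
  then show "linear_ext \<phi> (fscale c f) = fscale c (linear_ext \<phi> f)"
    by (simp add: linear_ext_superset[of "Poly_Mapping.keys f"] lookup_fscale fscale_sum)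
qed

lemma linear_ext_wd [simp]: "linear_ext \<phi> (wd w) = \<phi> w"
  by (simp add: linear_ext_def)

lemma linear_map_linear_ext_param:
  assumes "\<And>w. linear_map (\<lambda>g. \<phi> g w)"
  shows "linear_map (\<lambda>g. linear_ext (\<phi> g) f)"
  unfolding linear_map_def linear_ext_def
  using assms by (simp add: linear_map_def fscale_add sum.distrib fscale_sum mult.commute)

lemma wd_nonzero: "wd w \<noteq> (0 :: ('g, 'k::field) free)"
  by (metis lookup_single_eq lookup_zero one_neq_zero)

lemma wd_mult: "wd p * wd q = wd (p @ q)"
  by (simp add: mult_single plus_word_def)

section \<open>The normal form module\<close>

text \<open>
  \<open>letter True h i j\<close> is $h_{ij}$ and \<open>letter False h i j\<close> is $h_{ji}^*$, so that all relations are
  symmetric under exchanging \<open>True\<close> and \<open>False\<close>.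
\<close>

definition letter :: "bool \<Rightarrow> 'e \<Rightarrow> nat \<Rightarrow> nat \<Rightarrow> ('v, 'e) lpa_gen" where
  "letter d h l r = (if d then Edge h l r else Ghost h r l)"

lemma letter_eq_iff [simp]:
  "letter d h l r = letter d' h' l' r' \<longleftrightarrow> d = d' \<and> h = h' \<and> l = l' \<and> r = r'"
  "letter d h l r \<noteq> Vert u" "Vert u \<noteq> letter d h l r"
  by (auto simp: letter_def)

lemma gen_cases:
  obtains u where "z = Vert u" | d h l r where "z = letter d h l r"
  by (cases z) (metis letter_def)+

text \<open>Gives the second factors of the other summands when a reducible product is rewritten;
  they differ from the original one in the inner index only.\<close>

fun set_left :: "nat \<Rightarrow> ('v, 'e) lpa_gen \<Rightarrow> ('v, 'e) lpa_gen" where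
  "set_left k (Edge h i j) = Edge h k j"
| "set_left k (Ghost h i j) = Ghost h i k"
| "set_left k (Vert u) = Vert u"

lemma set_left_letter [simp]: "set_left k (letter d h l r) = letter d h k r"
  by (simp add: letter_def)

text \<open>A word is reducible at its products $h_{i1} h_{j1}^*$ and $h_{1i}^* h_{1j}$.\<close>

definition forbidden :: "('v, 'e) lpa_gen \<Rightarrow> ('v, 'e) lpa_gen \<Rightarrow> bool" where
  "forbidden z z' \<longleftrightarrow> (\<exists>d h l r. z = letter d h l 0 \<and> z' = letter (\<not> d) h 0 r)"

lemma forbidden_letter [simp]:
  "forbidden (letter d h l r) (letter d' h' l' r') \<longleftrightarrow> d' = (\<not> d) \<and> h' = h \<and> r = 0 \<and> l' = 0"
  "\<not> forbidden (Vert u) z" "\<not> forbidden z (Vert u)"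
  by (auto simp: forbidden_def)

section \<open>The relations in symmetric form\<close>

context listed_hypergraph
begin

definition row_verts :: "bool \<Rightarrow> 'e \<Rightarrow> 'v list" where
  "row_verts d h = (if d then S h else R h)"

text \<open>\<open>letter d h\<close> is a matrix with \<open>rows d h\<close> rows and
  \<open>rows (\<not> d) h\<close> columns, so one function gives both sizes.\<close>

definition rows :: "bool \<Rightarrow> 'e \<Rightarrow> nat" where
  "rows d h = size (if d then src H h else rng H h)"

definition edge_gens :: "('v, 'e) lpa_gen set" where
  "edge_gens = {letter d h l r | d h l r. h \<in> hedges H \<and> l < rows d h \<and> r < rows (\<not> d) h}"

lemma letter_in_edge_gens [simp]:
  "letter d h l r \<in> edge_gens \<longleftrightarrow> h \<in> hedges H \<and> l < rows d h \<and> r < rows (\<not> d) h"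
  by (auto simp: edge_gens_def)

lemma edge_gensE:
  assumes "z \<in> edge_gens"
  obtains d h l r where "z = letter d h l r" "h \<in> hedges H" "l < rows d h" "r < rows (\<not> d) h"
  using assms by (auto simp: edge_gens_def)

lemma Vert_notin_edge_gens [simp]: "Vert u \<notin> edge_gens"
  by (auto simp: edge_gens_def)

lemma lpa_gens_eq: "lpa_gens H = Vert ` verts H \<union> edge_gens"
proof -
  have "edge_gens = (\<Union>d. {letter d h l r | h l r. h \<in> hedges H \<and> l < rows d h \<and> r < rows (\<not> d) h})"
    by (auto simp: edge_gens_def)
  also have "\<dots> = {Edge h i j | h i j. h \<in> hedges H \<and> i < size (src H h) \<and> j < size (rng H h)} \<union>
     {Ghost h i j | h i j. h \<in> hedges H \<and> i < size (src H h) \<and> j < size (rng H h)}"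
    by (auto simp: UNIV_bool letter_def rows_def)
  finally show ?thesis
    by (auto simp: lpa_gens_def)
qed

lemma rows_pos: "h \<in> hedges H \<Longrightarrow> 0 < rows d h"
  using src[of h] rng[of h] by (simp add: rows_def nonempty_has_size)

lemma row_verts_in_verts: "h \<in> hedges H \<Longrightarrow> i < rows d h \<Longrightarrow> row_verts d h ! i \<in> verts H"
  using src[of h] rng[of h] src_listing[of h] rng_listing[of h]
  by (simp add: rows_def row_verts_def split: if_splits) (metis nth_mem set_mset_mset size_mset subsetD)+

text \<open>The equations for edges and those for ghosts become one family each, indexed by
  \<open>d\<close>; arguments about relators then need four cases.\<close>

lemma lpa_rels_cases:
  assumes "f \<in> lpa_rels H S R"
  obtains
    (verts) u v where "f = vert u * vert v - (if u = v then vert u else 0)" "u \<in> verts H" "v \<in> verts H"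
  | (left) d h l r where "f = vert (row_verts d h ! l) * gen (letter d h l r) - gen (letter d h l r)"
      "letter d h l r \<in> edge_gens"
  | (right) d h l r where "f = gen (letter d h l r) * vert (row_verts (\<not> d) h ! r) - gen (letter d h l r)"
      "letter d h l r \<in> edge_gens"
  | (sum) d h i j where
      "f = (\<Sum>k<rows (\<not> d) h. gen (letter d h i k) * gen (letter (\<not> d) h k j)) -
        (if i = j then vert (row_verts d h ! i) else 0)"
      "h \<in> hedges H" "i < rows d h" "j < rows d h"
proof -
  note letterI = letter_def[of True, simplified, symmetric] letter_def[of False, simplified, symmetric]
  show thesis
    using assms unfolding lpa_rels_def
  proof (elim UnE, goal_cases)
    case 1
    then show ?case using verts by blast
  next
    case 2
    then obtain h i j where h: "h \<in> hedges H" "i < rows True h" "j < rows False h"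
      and f: "f \<in> {vert (S h ! i) * edge h i j - edge h i j,
         edge h i j * vert (R h ! j) - edge h i j,
         vert (R h ! j) * ghost h i j - ghost h i j,
         ghost h i j * vert (S h ! i) - ghost h i j}"
      by (auto simp: rows_def)
    then show ?case
      using left[of True h i j] left[of False h j i] right[of True h i j] right[of False h j i]
      by (auto simp: letterI row_verts_def)
  next
    case 3
    then obtain h i j where h: "h \<in> hedges H" "i < rows True h" "j < rows True h"
      and f: "f = (\<Sum>k<rows False h. edge h i k * ghost h j k) - (if i = j then vert (S h ! i) else 0)"
      by (auto simp: rows_def)
    then show ?case
      using sum[of True h i j] by (simp add: letterI row_verts_def)
  next
    case 4
    then obtain h i j where h: "h \<in> hedges H" "i < rows False h" "j < rows False h"
      and f: "f = (\<Sum>k<rows True h. ghost h k i * edge h k j) - (if i = j then vert (R h ! i) else 0)"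
      by (auto simp: rows_def)
    then show ?case
      using sum[of False h i j] by (simp add: letterI row_verts_def)
  qed
qed

lemma lpa_relsI:
  fixes L :: "(('v, 'e) lpa_gen, 'k::field) free set"
  defines "L \<equiv> lpa_rels H S R"
  shows "u \<in> verts H \<Longrightarrow> v \<in> verts H \<Longrightarrow>
      vert u * vert v - (if u = v then vert u else 0) \<in> L"
    and "letter d h l r \<in> edge_gens \<Longrightarrow>
      vert (row_verts d h ! l) * gen (letter d h l r) - gen (letter d h l r) \<in> L"
    and "letter d h l r \<in> edge_gens \<Longrightarrow>
      gen (letter d h l r) * vert (row_verts (\<not> d) h ! r) - gen (letter d h l r) \<in> L"
    and "h \<in> hedges H \<Longrightarrow> i < rows d h \<Longrightarrow> j < rows d h \<Longrightarrow>
      (\<Sum>k<rows (\<not> d) h. gen (letter d h i k) * gen (letter (\<not> d) h k j)) -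
        (if i = j then vert (row_verts d h ! i) else 0) \<in> L"
proof -
  show "vert u * vert v - (if u = v then vert u else 0) \<in> L"
    if "u \<in> verts H" "v \<in> verts H"
    unfolding L_def lpa_rels_def using that by blast
  have four: "{vert (S h ! i) * edge h i j - edge h i j, edge h i j * vert (R h ! j) - edge h i j,
       vert (R h ! j) * ghost h i j - ghost h i j, ghost h i j * vert (S h ! i) - ghost h i j}
      \<subseteq> L"
    if "h \<in> hedges H" "i < rows True h" "j < rows False h" for i j
    unfolding L_def lpa_rels_def
    by (rule subsetI, rule UnI1, rule UnI1, rule UnI2, rule UN_I[of h], rule that(1),
        rule UN_I[of i], use that(2) in \<open>simp add: rows_def\<close>, rule UN_I[of j],
        use that(3) in \<open>simp add: rows_def\<close>, assumption)
  show "vert (row_verts d h ! l) * gen (letter d h l r) - gen (letter d h l r) \<in> L"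
    and "gen (letter d h l r) * vert (row_verts (\<not> d) h ! r) - gen (letter d h l r) \<in> L"
    if "letter d h l r \<in> edge_gens"
  proof (atomize (full), cases d)
    case True
    then have "h \<in> hedges H" "l < rows True h" "r < rows False h"
      using that letter_in_edge_gens[of d h l r] by simp_all
    from four[OF this] True
    show "vert (row_verts d h ! l) * gen (letter d h l r) - gen (letter d h l r) \<in> L \<and>
      gen (letter d h l r) * vert (row_verts (\<not> d) h ! r) - gen (letter d h l r) \<in> L"
      unfolding insert_subset letter_def row_verts_def by simp
  next
    case False
    then have "h \<in> hedges H" "r < rows True h" "l < rows False h"
      using that letter_in_edge_gens[of d h l r] by simp_all
    from four[OF this] False
    show "vert (row_verts d h ! l) * gen (letter d h l r) - gen (letter d h l r) \<in> L \<and>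
      gen (letter d h l r) * vert (row_verts (\<not> d) h ! r) - gen (letter d h l r) \<in> L"
      unfolding insert_subset letter_def row_verts_def by simp
  qed
  show "(\<Sum>k<rows (\<not> d) h. gen (letter d h i k) * gen (letter (\<not> d) h k j)) -
      (if i = j then vert (row_verts d h ! i) else 0) \<in> L"
    if "h \<in> hedges H" "i < rows d h" "j < rows d h"
  proof (cases d)
    case True
    show ?thesis
      unfolding L_def lpa_rels_def
      by (rule UnI1, rule UnI2, rule CollectI, rule exI[of _ h], rule exI[of _ i], rule exI[of _ j])
        (use that True in \<open>simp add: rows_def row_verts_def letter_def\<close>)
  next
    case False
    show ?thesis
      unfolding L_def lpa_rels_def
      by (rule UnI2, rule CollectI, rule exI[of _ h], rule exI[of _ i], rule exI[of _ j])
        (use that False in \<open>simp add: rows_def row_verts_def letter_def\<close>)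
  qed
qed

section \<open>Normal words and the action on their span\<close>

fun start :: "('v, 'e) lpa_gen \<Rightarrow> 'v" where
  "start (Vert u) = u"
| "start (Edge h i j) = S h ! i"
| "start (Ghost h i j) = R h ! j"

lemma start_letter [simp]: "start (letter d h l r) = row_verts d h ! l"
  by (simp add: letter_def row_verts_def)

definition joins :: "('v, 'e) lpa_gen \<Rightarrow> ('v, 'e) lpa_gen \<Rightarrow> bool" where
  "joins z z' \<longleftrightarrow> (\<exists>d h l r. z = letter d h l r \<and> start z' = row_verts (\<not> d) h ! r) \<and> \<not> forbidden z z'"

lemma joins_letter [simp]:
  "joins (letter d h l r) z' \<longleftrightarrow> start z' = row_verts (\<not> d) h ! r \<and> \<not> forbidden (letter d h l r) z'"
  by (auto simp: joins_def)

text \<open>The closing vertex records where a path ends and keeps every word nonempty: a vertex is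
  its own normal word, and \<open>h_{ij}\<close> is represented by
  \<open>h_{ij} r(h)_j\<close>.\<close>

definition normal :: "('v, 'e) lpa_gen list \<Rightarrow> bool" where
  "normal w \<longleftrightarrow> w \<noteq> [] \<and> last w \<in> Vert ` verts H \<and> set (butlast w) \<subseteq> edge_gens \<and> successively joins w"

definition normal_span :: "(('v, 'e) lpa_gen, 'k::field) free set" where
  "normal_span = {g. \<forall>w\<in>Poly_Mapping.keys g. normal (letters w)}"

lemma normal_Vert [simp]: "normal [Vert u] \<longleftrightarrow> u \<in> verts H"
  by (auto simp: normal_def)

lemma normal_Cons:
  "w \<noteq> [] \<Longrightarrow> normal (z # w) \<longleftrightarrow> z \<in> edge_gens \<and> joins z (hd w) \<and> normal w"
  by (cases w) (auto simp: normal_def)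

lemma normal_span_0: "0 \<in> normal_span"
  and normal_span_wd: "normal w \<Longrightarrow> wd w \<in> normal_span"
  by (simp_all add: normal_span_def)

lemma normal_span_add: "f \<in> normal_span \<Longrightarrow> g \<in> normal_span \<Longrightarrow> f + g \<in> normal_span"
  using Poly_Mapping.keys_add[of f g] by (fastforce simp: normal_span_def)

lemma normal_span_fscale: "f \<in> normal_span \<Longrightarrow> fscale c f \<in> normal_span"
  by (auto simp: normal_span_def in_keys_iff lookup_fscale)

lemma normal_span_diff: "f \<in> normal_span \<Longrightarrow> g \<in> normal_span \<Longrightarrow> f - g \<in> normal_span"
  using normal_span_add[of f "fscale (- 1) g"] normal_span_fscale[of g "- 1"]
  by (simp add: fscale_uminus_one)

lemma normal_span_uminus: "f \<in> normal_span \<Longrightarrow> - f \<in> normal_span"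
  using normal_span_fscale[of f "- 1"] by (simp add: fscale_uminus_one)

lemma normal_span_sum: "(\<And>x. x \<in> A \<Longrightarrow> u x \<in> normal_span) \<Longrightarrow> sum u A \<in> normal_span"
  by (induction A rule: infinite_finite_induct) (auto simp: normal_span_0 intro: normal_span_add)

lemma linear_map_normal_span_closed:
  assumes "linear_map T" "\<And>w. normal w \<Longrightarrow> T (wd w) \<in> normal_span" "f \<in> normal_span"
  shows "T f \<in> normal_span"
  unfolding linear_map_expand[OF assms(1), of f]
  by (intro normal_span_sum normal_span_fscale assms(2))
    (use assms(3) in \<open>simp add: normal_span_def\<close>)

lemma linear_map_normal_span_eqI:
  assumes "linear_map T" "linear_map U" "\<And>w. normal w \<Longrightarrow> T (wd w) = U (wd w)" "f \<in> normal_span"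
  shows "T f = U f"
  by (rule linear_map_eqI[OF assms(1,2)], rule assms(3))
    (use assms(4) in \<open>simp add: normal_span_def\<close>)

text \<open>The case of a reducible product is relation (iii) or (iv) solved for its first summand.\<close>

definition act_letter ::
    "bool \<Rightarrow> 'e \<Rightarrow> nat \<Rightarrow> nat \<Rightarrow> ('v, 'e) lpa_gen list \<Rightarrow> (('v, 'e) lpa_gen, 'k::field) free" where
  "act_letter d h l r w =
    (if start (hd w) \<noteq> row_verts (\<not> d) h ! r then 0
     else if forbidden (letter d h l r) (hd w) then
       (if \<exists>r'. hd w = letter (\<not> d) h 0 r' \<and> r' = l then wd (tl w) else 0) -
       (\<Sum>k\<in>{1..<rows (\<not> d) h}. wd (letter d h l k # set_left k (hd w) # tl w))
     else wd (letter d h l r # w))"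

fun act_word :: "('v, 'e) lpa_gen \<Rightarrow> ('v, 'e) lpa_gen list \<Rightarrow> (('v, 'e) lpa_gen, 'k::field) free" where
  "act_word (Vert u) w = (if start (hd w) = u then wd w else 0)"
| "act_word (Edge h i j) w = act_letter True h i j w"
| "act_word (Ghost h i j) w = act_letter False h j i w"

lemma act_word_letter [simp]: "act_word (letter d h l r) = act_letter d h l r"
  by (auto simp: letter_def)

definition act ::
    "('v, 'e) lpa_gen \<Rightarrow> (('v, 'e) lpa_gen, 'k::field) free \<Rightarrow> (('v, 'e) lpa_gen, 'k) free" where
  "act z = linear_ext (act_word z)"

definition rho ::
    "(('v, 'e) lpa_gen, 'k::field) free \<Rightarrow> (('v, 'e) lpa_gen, 'k) free \<Rightarrow> (('v, 'e) lpa_gen, 'k) free" where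
  "rho f g = linear_ext (\<lambda>w. foldr act w g) f"

lemma linear_map_act: "linear_map (act z)"
  by (simp add: act_def linear_map_linear_ext)

lemmas act_simps = linear_map_simps[OF linear_map_act]

lemma act_wd [simp]: "act z (wd w) = act_word z w"
  by (simp add: act_def)

lemma linear_map_foldr_act: "linear_map (foldr act w)"
proof (induction w)
  case Nil
  then show ?case by (simp add: linear_map_def)
next
  case (Cons z w)
  then show ?case by (simp add: linear_map_def act_simps)
qed

lemma linear_map_rho_left: "linear_map (\<lambda>f. rho f g)"
  unfolding rho_def by (rule linear_map_linear_ext)

lemma linear_map_rho: "linear_map (rho f)"
  unfolding rho_def by (intro linear_map_linear_ext_param linear_map_foldr_act)

lemmas rho_left_simps = linear_map_simps[OF linear_map_rho_left]
lemmas rho_simps = linear_map_simps[OF linear_map_rho]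

lemma rho_wd [simp]: "rho (wd w) g = foldr act w g"
  by (simp add: rho_def)

lemma rho_gen [simp]: "rho (gen z) g = act z g"
  by (simp add: gen_def)

lemma rho_mult: "rho (f * f') g = rho f (rho f' g)"
proof -
  have *: "rho (wd p * f') g = rho (wd p) (rho f' g)" for p
  proof (rule linear_map_eqI[of "\<lambda>f'. rho (wd p * f') g" "\<lambda>f'. rho (wd p) (rho f' g)"])
    show "linear_map (\<lambda>f'. rho (wd p * f') g)"
      by (rule linear_map_comp[OF linear_map_rho_left linear_map_times_left])
    show "linear_map (\<lambda>f'. rho (wd p) (rho f' g))"
      by (rule linear_map_comp[OF linear_map_rho linear_map_rho_left])
    show "rho (wd p * wd (letters q)) g = rho (wd p) (rho (wd (letters q)) g)" for q
      unfolding wd_mult rho_wd by simp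
  qed
  show ?thesis
  proof (rule linear_map_eqI[of "\<lambda>f. rho (f * f') g" "\<lambda>f. rho f (rho f' g)"])
    show "linear_map (\<lambda>f. rho (f * f') g)"
      by (rule linear_map_comp[OF linear_map_rho_left linear_map_times_right])
    show "linear_map (\<lambda>f. rho f (rho f' g))"
      by (rule linear_map_rho_left)
  qed (rule *)
qed

lemma forbiddenE:
  assumes "forbidden (letter d h l r) (hd w)" "normal w"
  obtains r' w' where "w = letter (\<not> d) h 0 r' # w'" "r = 0" "normal w'" "w' \<noteq> []"
    "letter (\<not> d) h 0 r' \<in> edge_gens" "joins (letter (\<not> d) h 0 r') (hd w')"
proof -
  obtain r' where r: "hd w = letter (\<not> d) h 0 r'" "r = 0"
    using assms(1) by (auto simp: forbidden_def)
  then obtain w' where w: "w = letter (\<not> d) h 0 r' # w'"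
    using assms(2) by (cases w) (auto simp: normal_def)
  moreover have "w' \<noteq> []"
    using assms(2) w by (auto simp: normal_def)
  ultimately show thesis
    using that r(2) assms(2) normal_Cons by metis
qed

lemma act_letter_forbidden:
  assumes "w' \<noteq> []"
  shows "act_letter d h l 0 (letter (\<not> d) h 0 r' # w') =
    (if r' = l then wd w' else 0) -
    (\<Sum>k\<in>{1..<rows (\<not> d) h}. wd (letter d h l k # letter (\<not> d) h k r' # w'))"
  by (simp add: act_letter_def)

text \<open>One step suffices: the new inner index is k \<ge> 1, so the two letters are no longer
  forbidden, and the second one changes only in its left index, which does not matter for its
  product with the next letter.\<close>

lemma act_word_normal_span:
  assumes "z \<in> lpa_gens H" "normal w"
  shows "act_word z w \<in> normal_span"
proof (cases z rule: gen_cases)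
  case (1 u)
  then show ?thesis
    using assms by (simp add: normal_span_0 normal_span_wd)
next
  case (2 d h l r)
  then have z: "h \<in> hedges H" "l < rows d h" "r < rows (\<not> d) h"
    using assms(1) by (auto simp: lpa_gens_eq)
  have "w \<noteq> []"
    using assms(2) by (auto simp: normal_def)
  show ?thesis
  proof (cases "forbidden (letter d h l r) (hd w)")
    case True
    then obtain r' w' where w: "w = letter (\<not> d) h 0 r' # w'" "r = 0" "normal w'" "w' \<noteq> []"
      "letter (\<not> d) h 0 r' \<in> edge_gens" "joins (letter (\<not> d) h 0 r') (hd w')"
      using forbiddenE assms(2) by blast
    have "normal (letter d h l k # letter (\<not> d) h k r' # w')" if "k \<in> {1..<rows (\<not> d) h}" for k
    proof -
      have "joins (letter (\<not> d) h k r') (hd w')"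
        using w(6) by (auto simp: forbidden_def)
      then show ?thesis
        using w z that by (simp add: normal_Cons)
    qed
    then show ?thesis
      using w by (auto simp: 2 act_letter_forbidden
        intro!: normal_span_diff normal_span_uminus normal_span_sum normal_span_wd normal_span_0)
  next
    case False
    then show ?thesis
      using z assms(2) \<open>w \<noteq> []\<close>
      by (auto simp: 2 act_letter_def normal_Cons normal_span_0 intro!: normal_span_wd)
  qed
qed

lemma act_normal_span: "z \<in> lpa_gens H \<Longrightarrow> g \<in> normal_span \<Longrightarrow> act z g \<in> normal_span"
  by (rule linear_map_normal_span_closed[OF linear_map_act]) (simp_all add: act_word_normal_span)

lemma foldr_act_normal_span:
  "set w \<subseteq> lpa_gens H \<Longrightarrow> g \<in> normal_span \<Longrightarrow> foldr act w g \<in> normal_span"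
  by (induction w) (simp_all add: act_normal_span)

lemma rho_normal_span:
  assumes "f \<in> free_carr (lpa_gens H)" "g \<in> normal_span"
  shows "rho f g \<in> normal_span"
  using assms unfolding rho_def linear_ext_def
  by (auto simp: free_carr_def intro!: normal_span_sum normal_span_fscale foldr_act_normal_span)

section \<open>The relations act as zero\<close>

lemma sum_lessThan_split: "0 < (n::nat) \<Longrightarrow> (\<Sum>k<n. f k) = f 0 + (\<Sum>k\<in>{1..<n}. f k)"
  by (simp add: sum.atLeast_Suc_lessThan lessThan_atLeast0)

text \<open>Of the summands only \<open>k = 0\<close> is rewritten, and the sum that it yields
  cancels the summands with k \<ge> 1.\<close>

lemma act_inverse_matrices_aux:
  assumes "h \<in> hedges H" "start (hd w) = row_verts d h ! j" "w \<noteq> []"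
  shows "(\<Sum>k<rows (\<not> d) h. act_letter d h i k (letter (\<not> d) h k j # w)) = (if i = j then wd w else 0)"
proof -
  have *: "(\<Sum>k\<in>{1..<rows (\<not> d) h}. act_letter d h i k (letter (\<not> d) h k j # w)) =
      (\<Sum>k\<in>{1..<rows (\<not> d) h}. wd (letter d h i k # letter (\<not> d) h k j # w))"
    by (rule sum.cong) (auto simp: act_letter_def)
  show ?thesis
    using assms rows_pos[of h "\<not> d"]
    by (simp add: sum_lessThan_split act_letter_forbidden * del: One_nat_def)
qed

text \<open>This takes the place of the confluence check. The critical overlap, three letters of
  \<open>h\<close> of alternating kind, occurs in the third case.\<close>

lemma act_inverse_matrices:
  assumes "h \<in> hedges H" "i < rows d h" "j < rows d h" "normal w"
  shows "(\<Sum>k<rows (\<not> d) h. act (letter d h i k) (act (letter (\<not> d) h k j) (wd w))) =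
    (if i = j then act (Vert (row_verts d h ! i)) (wd w) else 0)"
proof -
  have "w \<noteq> []"
    using assms(4) by (auto simp: normal_def)
  consider "start (hd w) \<noteq> row_verts d h ! j"
    | "start (hd w) = row_verts d h ! j" "\<not> forbidden (letter (\<not> d) h 0 j) (hd w)"
    | "start (hd w) = row_verts d h ! j" "forbidden (letter (\<not> d) h 0 j) (hd w)"
    by blast
  then show ?thesis
  proof cases
    case 1
    then show ?thesis
      by (simp add: act_letter_def act_simps)
  next
    case 2
    have "\<not> forbidden (letter (\<not> d) h k j) (hd w)" for k
      using 2(2) by (auto simp: forbidden_def)
    then have a: "act_letter (\<not> d) h k j w = wd (letter (\<not> d) h k j # w)" for k
      using 2 by (simp add: act_letter_def)
    show ?thesis
      using 2(1) by (simp add: a act_inverse_matrices_aux[OF assms(1) 2(1) \<open>w \<noteq> []\<close>])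
  next
    case 3
    then obtain p w' where w: "w = letter d h 0 p # w'" "j = 0" "normal w'" "w' \<noteq> []"
      "letter d h 0 p \<in> edge_gens" "joins (letter d h 0 p) (hd w')"
      using forbiddenE[OF 3(2) assms(4)] by auto
    have p: "p < rows (\<not> d) h"
      using w(5) by simp
    have ip: "act_letter d h i p w' = wd (letter d h i p # w')"
      using w(6) by (auto simp: act_letter_def forbidden_def)
    have a: "act_letter (\<not> d) h k 0 w = (if p = k then wd w' else 0) -
        (\<Sum>q\<in>{1..<rows d h}. wd (letter (\<not> d) h k q # letter d h q p # w'))" for k
      using act_letter_forbidden[OF w(4), of "\<not> d" h k p] by (simp add: w(1))
    have "(\<Sum>k<rows (\<not> d) h. act (letter d h i k) (act (letter (\<not> d) h k 0) (wd w))) =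
        ((\<Sum>k<rows (\<not> d) h. if p = k then act_letter d h i k w' else 0) -
        (\<Sum>k<rows (\<not> d) h. \<Sum>q\<in>{1..<rows d h}.
          act_letter d h i k (letter (\<not> d) h k q # letter d h q p # w')) ::
        (('v, 'e) lpa_gen, 'a) free)"
      by (simp add: a act_simps sum_subtractf if_distrib[of "act _"] cong: if_cong)
    \<comment> \<open>After the swap, the sum over \<open>k\<close> is an instance of
      \<open>act_inverse_matrices_aux\<close> for each \<open>q\<close>.\<close>
    also have "\<dots> = wd (letter d h i p # w') -
        (\<Sum>q\<in>{1..<rows d h}. \<Sum>k<rows (\<not> d) h.
          act_letter d h i k (letter (\<not> d) h k q # letter d h q p # w'))"
      using p by (subst sum.swap) (simp add: ip)
    also have "\<dots> = wd (letter d h i p # w') -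
        (\<Sum>q\<in>{1..<rows d h}. if i = q then wd (letter d h q p # w') else 0)"
      by (simp add: act_inverse_matrices_aux[OF assms(1)])
    \<comment> \<open>As \<open>q\<close> starts at 1, the subtracted sum removes the first term
      unless i = 0.\<close>
    also have "\<dots> = (if i = 0 then wd (letter d h i p # w') else 0)"
      using assms(2) by (simp add: sum.delta')
    also have "\<dots> = (if i = 0 then wd w else 0)"
      by (simp add: w(1))
    finally show ?thesis
      using 3(1) by (simp add: w(2))
  qed
qed

lemma rho_lpa_rels:
  assumes "f \<in> lpa_rels H S R" "g \<in> normal_span"
  shows "rho f g = 0"
proof -
  have "rho f (wd w) = 0" if w: "normal w" for w
    using assms(1)
  proof (cases rule: lpa_rels_cases)
    case (verts u v)
    then show ?thesis
      by (simp add: rho_left_simps rho_mult act_simps)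
  next
    case (left d h l r)
    have "act (Vert (row_verts d h ! l)) (act_letter d h l r w) = act_letter d h l r w"
    proof (cases "forbidden (letter d h l r) (hd w)")
      case True
      then obtain r' w' where "w = letter (\<not> d) h 0 r' # w'" "r = 0" "normal w'" "w' \<noteq> []"
        "letter (\<not> d) h 0 r' \<in> edge_gens" "joins (letter (\<not> d) h 0 r') (hd w')"
        using forbiddenE w by blast
      then show ?thesis
        by (auto simp: act_letter_forbidden act_simps)
    next
      case False
      then show ?thesis
        by (simp add: act_letter_def act_simps)
    qed
    then show ?thesis
      by (simp add: left(1) rho_left_simps rho_mult)
  next
    case (right d h l r)
    then show ?thesis
      by (simp add: right(1) rho_left_simps rho_mult act_simps act_letter_def)
  next
    case (sum d h i j)
    then show ?thesis
      using act_inverse_matrices[OF sum(2-4) w]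
      by (simp add: rho_left_simps rho_mult if_distrib[of "\<lambda>f. rho f _"] cong: if_cong)
  qed
  then show ?thesis
    using linear_map_normal_span_eqI[OF linear_map_rho linear_map_zero _ assms(2)] by blast
qed

text \<open>The elements annihilating \<open>normal_span\<close> form an ideal, since
  \<open>normal_span\<close> is stable under the action, and this ideal contains the
  relators.\<close>

lemma rho_ideal:
  assumes "f \<in> gen_ideal (lpa_gens H) (lpa_rels H S R)" "g \<in> normal_span"
  shows "rho f g = 0"
proof -
  let ?I = "{f \<in> free_carr (lpa_gens H). \<forall>g\<in>normal_span. rho f g = 0}"
  have "free_ideal (lpa_gens H) ?I"
    unfolding free_ideal_def
    by (auto simp: rho_left_simps rho_mult rho_simps rho_normal_span free_carr_zero
      free_carr_add free_carr_fscale free_carr_mult)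
  moreover have "lpa_rels H S R \<subseteq> ?I"
    using lpa_rels_subset rho_lpa_rels by blast
  ultimately show ?thesis
    using assms unfolding gen_ideal_def by blast
qed

lemma vert_notin_ideal:
  assumes "u \<in> verts H"
  shows "vert u \<notin> gen_ideal (lpa_gens H) (lpa_rels H S R)"
proof
  assume "vert u \<in> gen_ideal (lpa_gens H) (lpa_rels H S R)"
  from rho_ideal[OF this, of "wd [Vert u]"] assms show False
    by (simp add: normal_span_wd wd_nonzero)
qed

section \<open>Zero divisors modulo the ideal of relations\<close>

lemma nu_domain_iff:
  "nu_domain (leavitt_path_algebra H S R :: ('k::field, (('v, 'e) lpa_gen, 'k) free set) nu_alg) \<longleftrightarrow>
    (\<forall>f\<in>free_carr (lpa_gens H). \<forall>g\<in>free_carr (lpa_gens H).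
      f * g \<in> gen_ideal (lpa_gens H) (lpa_rels H S R :: (('v, 'e) lpa_gen, 'k) free set) \<longrightarrow>
      f \<in> gen_ideal (lpa_gens H) (lpa_rels H S R) \<or> g \<in> gen_ideal (lpa_gens H) (lpa_rels H S R))"
    (is "nu_domain ?L \<longleftrightarrow> ?P")
proof -
  have L: "?L = presented (lpa_gens H) (lpa_rels H S R)"
    by (simp add: leavitt_path_algebra_def)
  have zero: "lpa.cls f = zero ?L \<longleftrightarrow> f \<in> gen_ideal (lpa_gens H) (lpa_rels H S R)"
    if "f \<in> free_carr (lpa_gens H)" for f :: "(('v, 'e) lpa_gen, 'k) free"
    using lpa.cls_eq_iff[OF that free_carr_zero] by (simp add: L lpa.zero_cls)
  have "verts H \<noteq> {}"
    using nonempty src by (metis ex_in_conv set_mset_eq_empty_iff subset_empty)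
  then obtain u where u: "u \<in> verts H"
    by blast
  let ?u = "vert u :: (('v, 'e) lpa_gen, 'k) free"
  have free: "?u \<in> free_carr (lpa_gens H)"
    using u by (intro free_carr_gen) (simp add: lpa_gens_eq)
  then have "lpa.cls ?u \<in> carr ?L"
    by (simp add: L lpa.carr_eq)
  moreover have "lpa.cls ?u \<noteq> zero ?L"
    using vert_notin_ideal[OF u] by (simp add: zero[OF free])
  ultimately have nz: "carr ?L \<noteq> {zero ?L}"
    by blast
  have "nu_ring ?L"
    using nu_algebra_leavitt_path_algebra nu_algebra.axioms(1) by blast
  then have "nu_domain ?L \<longleftrightarrow> (\<forall>x\<in>carr ?L. \<forall>y\<in>carr ?L. mult ?L x y = zero ?L \<longrightarrow>
      x = zero ?L \<or> y = zero ?L)"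
    using nz by (auto simp: nu_domain_def nu_domain_axioms_def)
  also have "\<dots> \<longleftrightarrow> ?P"
    by (simp add: L lpa.carr_eq lpa.mult_cls zero[unfolded L] free_carr_mult)
  finally show ?thesis .
qed

abbreviation lpa_ideal :: "(('v, 'e) lpa_gen, 'k::field) free set" where
  "lpa_ideal \<equiv> gen_ideal (lpa_gens H) (lpa_rels H S R)"

lemma lpa_ideal_diff: "f \<in> lpa_ideal \<Longrightarrow> g \<in> lpa_ideal \<Longrightarrow> f - g \<in> lpa_ideal"
  using lpa.ideal_props(2)[of f "- g"] lpa.ideal_uminus[of g] by simp

lemma lpa_ideal_sum: "(\<And>x. x \<in> A \<Longrightarrow> u x \<in> lpa_ideal) \<Longrightarrow> sum u A \<in> lpa_ideal"
  by (induction A rule: infinite_finite_induct) (auto intro: lpa.ideal_props)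

lemma lpa_rels_ideal: "f \<in> lpa_rels H S R \<Longrightarrow> f \<in> lpa_ideal"
  using subset_gen_ideal by blast

text \<open>Distinct vertices are orthogonal. If one matrix of \<open>h\<close> is a row of length n
  \<ge> 2, the entries of column times row are single products; those off the diagonal vanish,
  although every entry of the row and of the column is a factor of a vertex.\<close>

lemma no_zero_divisors_imp:
  assumes dom: "\<And>f g. f \<in> free_carr (lpa_gens H) \<Longrightarrow> g \<in> free_carr (lpa_gens H) \<Longrightarrow>
    f * g \<in> (lpa_ideal :: (('v, 'e) lpa_gen, 'k::field) free set) \<Longrightarrow> f \<in> lpa_ideal \<or> g \<in> lpa_ideal"
  shows "card (verts H) = 1"
    and "h \<in> hedges H \<Longrightarrow> (rows True h \<ge> 2 \<and> rows False h \<ge> 2) \<or> (rows True h = 1 \<and> rows False h = 1)"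
proof -
  have free: "gen z \<in> (free_carr (lpa_gens H) :: (('v, 'e) lpa_gen, 'k) free set)"
    if "z \<in> lpa_gens H" for z
    using that by (rule free_carr_gen)
  have uniq: "u = u'" if "u \<in> verts H" "u' \<in> verts H" for u u'
  proof (rule ccontr)
    assume "u \<noteq> u'"
    then have "vert u * vert u' \<in> (lpa_ideal :: (('v, 'e) lpa_gen, 'k) free set)"
      using lpa_rels_ideal[OF lpa_relsI(1)[OF that]] by simp
    then show False
      using dom[OF free free] vert_notin_ideal that by (auto simp: lpa_gens_eq)
  qed
  have "verts H \<noteq> {}"
    using nonempty src by (metis ex_in_conv set_mset_eq_empty_iff subset_empty)
  then show "card (verts H) = 1"
    using uniq by (metis card_1_singleton_iff ex_in_conv is_singletonI' is_singleton_altdef)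
  show "(rows True h \<ge> 2 \<and> rows False h \<ge> 2) \<or> (rows True h = 1 \<and> rows False h = 1)" if h: "h \<in> hedges H"
  proof (rule ccontr)
    assume "\<not> ?thesis"
    then obtain d where d: "rows d h = 1" "rows (\<not> d) h \<ge> 2"
      using rows_pos[OF h, of True] rows_pos[OF h, of False]
      by (metis (full_types) One_nat_def Suc_leI le_antisym not_less_eq_eq numeral_2_eq_2)
    let ?g = "\<lambda>d l r. gen (letter d h l r) :: (('v, 'e) lpa_gen, 'k) free"
    have E: "letter (\<not> d) h i 0 \<in> lpa_gens H" "letter d h 0 i \<in> lpa_gens H" if "i < 2" for i
      using that d h by (auto simp: lpa_gens_eq)
    have rel: "?g (\<not> d) i 0 * ?g d 0 j - (if i = j then vert (row_verts (\<not> d) h ! i) else 0) \<in> lpa_ideal"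
      if "i < 2" "j < 2" for i j
      using lpa_rels_ideal[OF lpa_relsI(4)[OF h, of i "\<not> d" j]] d that by simp
    have notin: "?g (\<not> d) i 0 * ?g d 0 i \<notin> lpa_ideal" if "i < 2" for i
    proof
      assume "?g (\<not> d) i 0 * ?g d 0 i \<in> lpa_ideal"
      from lpa_ideal_diff[OF this rel[OF that that]]
      show False
        using row_verts_in_verts[OF h, of i "\<not> d"] d that by (simp add: vert_notin_ideal)
    qed
    have "?g (\<not> d) 0 0 * ?g d 0 1 \<in> lpa_ideal"
      using rel[of 0 1] by simp
    then have "?g (\<not> d) 0 0 \<in> lpa_ideal \<or> ?g d 0 1 \<in> lpa_ideal"
      by (rule dom[OF free[OF E(1)] free[OF E(2)], rotated 2]) simp_all
    then show False
    proof
      assume "?g (\<not> d) 0 0 \<in> lpa_ideal"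
      from lpa.ideal_props(4)[OF this free[OF E(2)[of 0]]] notin[of 0] show False
        by simp
    next
      assume "?g d 0 1 \<in> lpa_ideal"
      from lpa.ideal_props(5)[OF this free[OF E(1)[of 1]]] notin[of 1] show False
        by simp
    qed
  qed
qed

end

section \<open>Hypergraphs with one vertex\<close>

text \<open>In a 1 by 1 hyperedge all indices are 0, and being forbidden becomes being inverse, so
  irreducible words in these letters correspond to reduced group words.\<close>

definition unit_letter :: "'e \<times> bool \<Rightarrow> ('v, 'e) lpa_gen" where
  "unit_letter x = letter (snd x) (fst x) 0 0"

lemma inj_unit_letter: "inj unit_letter"
  by (auto intro!: injI simp: unit_letter_def prod_eq_iff)

lemma forbidden_unit_letter [simp]: "forbidden (unit_letter x) (unit_letter y) \<longleftrightarrow> y = flip x"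
  by (auto simp: unit_letter_def flip_def prod_eq_iff)

locale one_vertex_hypergraph = listed_hypergraph H S R
  for H :: "('v, 'e) hypergraph" and S R +
  fixes v :: 'v
  assumes verts_eq: "verts H = {v}"
    and sizes: "h \<in> hedges H \<Longrightarrow>
      (rows True h \<ge> 2 \<and> rows False h \<ge> 2) \<or> (rows True h = 1 \<and> rows False h = 1)"
begin

lemma start_eq: "z \<in> lpa_gens H \<Longrightarrow> start z = v"
  using row_verts_in_verts by (auto simp: lpa_gens_eq verts_eq elim!: edge_gensE)

text \<open>With a single vertex all letters are composable, so normality is a condition on the
  letters before the closing vertex, which \<open>wv\<close> puts back.\<close>

definition irred :: "('v, 'e) lpa_gen list \<Rightarrow> bool" where
  "irred p \<longleftrightarrow> set p \<subseteq> edge_gens \<and> successively (\<lambda>z z'. \<not> forbidden z z') p"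

abbreviation wv :: "('v, 'e) lpa_gen list \<Rightarrow> (('v, 'e) lpa_gen, 'k::field) free" where
  "wv p \<equiv> wd (p @ [Vert v])"

lemma irred_Nil [simp]: "irred []"
  by (simp add: irred_def)

lemma irred_append:
  "irred (p @ q) \<longleftrightarrow> irred p \<and> irred q \<and> (p = [] \<or> q = [] \<or> \<not> forbidden (last p) (hd q))"
  by (auto simp: irred_def successively_append_iff)

lemma irred_Cons:
  "irred (z # q) \<longleftrightarrow> z \<in> edge_gens \<and> irred q \<and> (q = [] \<or> \<not> forbidden z (hd q))"
  by (auto simp: irred_def successively_Cons)

lemma joins_iff:
  assumes "z \<in> edge_gens" "z' \<in> lpa_gens H"
  shows "joins z z' \<longleftrightarrow> \<not> forbidden z z'"
proof -
  obtain d h l r where z: "z = letter d h l r" "h \<in> hedges H" "r < rows (\<not> d) h"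
    using assms(1) by (elim edge_gensE)
  then show ?thesis
    using start_eq[OF assms(2)] row_verts_in_verts[of h r "\<not> d"] by (simp add: verts_eq)
qed

lemma normal_append_Vert: "normal (p @ [Vert v]) \<longleftrightarrow> irred p"
proof (induction p)
  case Nil
  then show ?case by (simp add: verts_eq)
next
  case (Cons z p)
  show ?case
  proof (cases p)
    case Nil
    then show ?thesis
      using joins_iff[of z "Vert v"] by (auto simp: normal_Cons irred_Cons verts_eq lpa_gens_eq)
  next
    case (Cons z' p')
    then have "z' \<in> lpa_gens H" if "irred p"
      using that by (auto simp: irred_Cons lpa_gens_eq)
    then show ?thesis
      using joins_iff[of z z'] Cons.IH Cons by (auto simp: normal_Cons irred_Cons)
  qed
qed

lemma normal_iff: "normal w \<longleftrightarrow> (\<exists>p. w = p @ [Vert v] \<and> irred p)"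
proof
  assume w: "normal w"
  then have "w = butlast w @ [Vert v]"
    by (auto simp: normal_def verts_eq dest: append_butlast_last_id)
  then show "\<exists>p. w = p @ [Vert v] \<and> irred p"
    using w normal_append_Vert by metis
qed (auto simp: normal_append_Vert)

lemma normal_gens:
  assumes "normal w"
  shows "w \<noteq> []" "set w \<subseteq> lpa_gens H"
  using assms by (auto simp: normal_iff lpa_gens_eq irred_def verts_eq)

lemma start_hd_normal: "normal w \<Longrightarrow> start (hd w) = v"
  using normal_gens[of w] by (intro start_eq) (auto dest: hd_in_set)

lemma wd_free_carr: "normal w \<Longrightarrow> wd w \<in> free_carr (lpa_gens H)"
  by (auto simp: normal_iff free_carr_def lpa_gens_eq irred_def verts_eq)

section \<open>The action as multiplication modulo the relations\<close>

lemma gen_mult_wd: "gen z * wd w = wd (z # w)"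
  by (simp add: gen_def wd_mult)

lemma vert_mult_wd:
  assumes "normal w"
  shows "vert v * wd w - wd w \<in> lpa_ideal"
proof -
  obtain z w' where w: "w = z # w'" "set w \<subseteq> lpa_gens H"
    using normal_gens[OF assms] by (cases w) simp_all
  have z: "vert v * gen z - gen z \<in> lpa_ideal"
  proof (cases z rule: gen_cases)
    case (1 u)
    then have "u = v"
      using w by (auto simp: lpa_gens_eq verts_eq)
    then show ?thesis
      using lpa_rels_ideal[OF lpa_relsI(1)[of v v]] 1 by (simp add: verts_eq)
  next
    case (2 d h l r)
    then have "letter d h l r \<in> edge_gens" "row_verts d h ! l = v"
      using w start_eq[of z] by (auto simp: lpa_gens_eq)
    then show ?thesis
      using lpa_rels_ideal[OF lpa_relsI(2)[of d h l r]] 2 by simp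
  qed
  show ?thesis
  proof (cases "w' = []")
    case True
    then show ?thesis
      using z w by (simp add: gen_def)
  next
    case False
    have "wd w' \<in> free_carr (lpa_gens H)"
      using False w by (auto simp: free_carr_def)
    from lpa.ideal_props(4)[OF z this] show ?thesis
      by (simp add: left_diff_distrib mult.assoc gen_mult_wd w)
  qed
qed

text \<open>Each case of \<open>act_letter\<close> follows from the relations, so acting and
  multiplying differ by an element of the ideal. Together with \<open>rho_ideal\<close> this lets
  the normal form decide membership in the ideal.\<close>

lemma gen_mult_wd_ideal:
  assumes "z \<in> lpa_gens H" "normal w"
  shows "gen z * wd w - act_word z w \<in> (lpa_ideal :: (('v, 'e) lpa_gen, 'k::field) free set)"
proof (cases z rule: gen_cases)
  case (1 u)
  then show ?thesis
    using assms vert_mult_wd[OF assms(2)] start_hd_normal[OF assms(2)]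
    by (auto simp: lpa_gens_eq verts_eq)
next
  case (2 d h l r)
  then have z: "h \<in> hedges H" "l < rows d h" "r < rows (\<not> d) h"
    using assms(1) by (auto simp: lpa_gens_eq)
  show ?thesis
  proof (cases "forbidden (letter d h l r) (hd w)")
    case True
    then obtain r' w' where w: "w = letter (\<not> d) h 0 r' # w'" "r = 0" "normal w'" "w' \<noteq> []"
      "letter (\<not> d) h 0 r' \<in> edge_gens" "joins (letter (\<not> d) h 0 r') (hd w')"
      using forbiddenE assms(2) by blast
    define X :: "(('v, 'e) lpa_gen, 'k) free"
      where "X = (\<Sum>k<rows (\<not> d) h. gen (letter d h l k) * gen (letter (\<not> d) h k r')) -
        (if l = r' then vert (row_verts d h ! l) else 0)"
    have "X \<in> lpa_ideal"
      unfolding X_def using w(5) z by (intro lpa_rels_ideal lpa_relsI(4)) auto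
    then have 1: "X * wd w' \<in> lpa_ideal"
      using wd_free_carr[OF w(3)] by (rule lpa.ideal_props(4))
    have 2: "(if l = r' then vert v * wd w' - wd w' else 0) \<in> lpa_ideal"
      by (simp add: vert_mult_wd[OF w(3)] lpa.ideal_props(1))
    have row_verts: "row_verts d h ! l = v"
      using row_verts_in_verts[OF z(1,2)] by (simp add: verts_eq)
    have "X * wd w' = (\<Sum>k<rows (\<not> d) h. wd (letter d h l k # letter (\<not> d) h k r' # w')) -
        (if l = r' then vert v * wd w' else 0)"
      using row_verts by (cases "l = r'")
        (simp_all add: X_def left_diff_distrib sum_distrib_right mult.assoc gen_mult_wd)
    \<comment> \<open>The relation supplies \<open>vert v * wd w'\<close> where the action has
      \<open>wd w'\<close>; the last term accounts for the difference.\<close>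
    also have "\<dots> = gen z * wd w - act_word z w - (if l = r' then vert v * wd w' - wd w' else 0)"
      using rows_pos[OF z(1), of "\<not> d"] w(2,4) row_verts
      by (cases "l = r'")
        (simp_all add: \<open>z = letter d h l r\<close> act_letter_forbidden gen_mult_wd w(1) sum_lessThan_split)
    finally show ?thesis
      using lpa.ideal_props(2)[OF 1 2] by simp
  next
    case False
    have "start (hd w) = row_verts (\<not> d) h ! r"
      using start_hd_normal[OF assms(2)] row_verts_in_verts[OF z(1,3)] by (simp add: verts_eq)
    then show ?thesis
      using False by (simp add: 2 act_letter_def gen_mult_wd lpa.ideal_props(1))
  qed
qed

lemma gen_mult_ideal:
  assumes "z \<in> lpa_gens H" "g \<in> normal_span"
  shows "gen z * g - act z g \<in> lpa_ideal"
proof -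
  have lm: "linear_map (\<lambda>g. gen z * g - act z g)"
    by (rule linear_map_diff[OF linear_map_times_left linear_map_act])
  have "gen z * wd (letters w) - act z (wd (letters w)) \<in> lpa_ideal" if "w \<in> Poly_Mapping.keys g" for w
    unfolding act_wd using that assms by (intro gen_mult_wd_ideal) (auto simp: normal_span_def)
  then show ?thesis
    unfolding linear_map_expand[OF lm, of g] by (intro lpa_ideal_sum lpa.ideal_props(3)) simp
qed

lemma wd_mult_ideal:
  assumes "set p \<subseteq> lpa_gens H" "g \<in> normal_span"
  shows "wd p * g - foldr act p g \<in> lpa_ideal"
  using assms(1)
proof (induction p)
  case Nil
  have "wd [] * g = g"
    by (simp flip: zero_word_def)
  then show ?case
    by (simp add: lpa.ideal_props(1))
next
  case (Cons z p)
  let ?G = "foldr act p g"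
  have "gen z * (wd p * g - ?G) \<in> lpa_ideal"
    using Cons by (intro lpa.ideal_props(5) free_carr_gen) auto
  moreover have "gen z * ?G - act z ?G \<in> lpa_ideal"
    using Cons.prems assms(2) by (intro gen_mult_ideal foldr_act_normal_span) auto
  ultimately have "gen z * (wd p * g - ?G) + (gen z * ?G - act z ?G) \<in> lpa_ideal"
    by (rule lpa.ideal_props(2))
  then show ?case
    by (simp add: right_diff_distrib gen_mult_wd flip: mult.assoc)
qed

lemma mult_rho_ideal:
  assumes "f \<in> free_carr (lpa_gens H)" "g \<in> normal_span"
  shows "f * g - rho f g \<in> lpa_ideal"
proof -
  have lm: "linear_map (\<lambda>f. f * g - rho f g)"
    by (rule linear_map_diff[OF linear_map_times_right linear_map_rho_left])
  have "wd (letters w) * g - rho (wd (letters w)) g \<in> lpa_ideal" if "w \<in> Poly_Mapping.keys f" for w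
    unfolding rho_wd using that assms by (intro wd_mult_ideal) (auto simp: free_carr_def)
  then show ?thesis
    unfolding linear_map_expand[OF lm, of f] by (intro lpa_ideal_sum lpa.ideal_props(3)) simp
qed

lemma mult_vert_ideal:
  assumes "f \<in> free_carr (lpa_gens H)"
  shows "f * vert v - f \<in> lpa_ideal"
proof -
  have lm: "linear_map (\<lambda>f. f * vert v - f)"
    by (rule linear_map_diff[OF linear_map_times_right linear_map_id])
  have gen: "gen z * vert v - gen z \<in> lpa_ideal" if "z \<in> lpa_gens H" for z
  proof (cases z rule: gen_cases)
    case (1 u)
    then have "u = v"
      using that by (auto simp: lpa_gens_eq verts_eq)
    then show ?thesis
      using lpa_rels_ideal[OF lpa_relsI(1)[of v v]] 1 by (simp add: verts_eq)
  next
    case (2 d h l r)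
    then have *: "letter d h l r \<in> edge_gens"
      using that by (auto simp: lpa_gens_eq)
    then have "row_verts (\<not> d) h ! r = v"
      using row_verts_in_verts[of h r "\<not> d"] by (simp add: verts_eq)
    then show ?thesis
      using lpa_rels_ideal[OF lpa_relsI(3)[OF *]] 2 by simp
  qed
  have "wd (letters w) * vert v - wd (letters w) \<in> lpa_ideal" if w: "w \<in> Poly_Mapping.keys f" for w
  proof -
    have "letters w \<noteq> []" and sub: "set (letters w) \<subseteq> lpa_gens H"
      using assms w by (auto simp: free_carr_def)
    then obtain p z where pz: "letters w = p @ [z]"
      by (metis append_butlast_last_id)
    have z: "gen z * vert v - gen z \<in> lpa_ideal"
      using sub pz by (intro gen) simp
    show ?thesis
    proof (cases "p = []")
      case True
      then show ?thesis
        unfolding pz using z by (simp add: gen_def)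
    next
      case False
      then have "wd p \<in> free_carr (lpa_gens H)"
        using sub pz by (auto simp: free_carr_def)
      from lpa.ideal_props(5)[OF z this] show ?thesis
        unfolding pz by (simp add: right_diff_distrib gen_def wd_mult flip: mult.assoc)
    qed
  qed
  then show ?thesis
    unfolding linear_map_expand[OF lm, of f] by (intro lpa_ideal_sum lpa.ideal_props(3)) simp
qed

lemma vert_normal_span: "vert v \<in> normal_span"
  unfolding gen_def by (rule normal_span_wd) (simp add: verts_eq)

text \<open>Modulo the ideal \<open>f\<close> agrees with \<open>f * vert v\<close>, and this with
  \<open>rho f (vert v)\<close>, the normal form of \<open>f\<close>.\<close>

lemma rho_vert_ideal:
  assumes "f \<in> free_carr (lpa_gens H)"
  shows "f - rho f (vert v) \<in> lpa_ideal"
  using lpa_ideal_diff[OF mult_rho_ideal[OF assms vert_normal_span] mult_vert_ideal[OF assms]]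
  by simp

section \<open>Degree and unit letters\<close>

definition big :: "('v, 'e) lpa_gen \<Rightarrow> bool" where
  "big z \<longleftrightarrow> (\<exists>d h l r. z = letter d h l r \<and> rows True h \<ge> 2)"

definition deg :: "('v, 'e) lpa_gen list \<Rightarrow> nat" where
  "deg p = length (filter big p)"

definition units :: "('e \<times> bool) list \<Rightarrow> bool" where
  "units a \<longleftrightarrow> (\<forall>x\<in>set a. fst x \<in> hedges H \<and> rows True (fst x) = 1)"

lemma big_letter [simp]: "big (letter d h l r) \<longleftrightarrow> rows True h \<ge> 2"
  by (auto simp: big_def)

text \<open>By \<open>sizes\<close> the two dimensions of a hyperedge are both 1 or both at least 2,
  so the test in \<open>big\<close> is symmetric in \<open>d\<close>.\<close>

lemma big_rows: "h \<in> hedges H \<Longrightarrow> rows d h \<ge> 2 \<longleftrightarrow> rows True h \<ge> 2"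
  using sizes[of h] by (cases d) auto

lemma unit_rows: "h \<in> hedges H \<Longrightarrow> rows d h = 1 \<longleftrightarrow> rows True h = 1"
  using sizes[of h] by (cases d) auto

lemma deg_simps [simp]:
  "deg [] = 0" "deg (z # p) = (if big z then 1 else 0) + deg p" "deg (p @ q) = deg p + deg q"
  by (simp_all add: deg_def)

lemma units_simps [simp]:
  "units []" "units (x # a) \<longleftrightarrow> fst x \<in> hedges H \<and> rows True (fst x) = 1 \<and> units a"
  "units (a @ b) \<longleftrightarrow> units a \<and> units b"
  by (auto simp: units_def)

lemma units_ginv [simp]: "units (ginv a) \<longleftrightarrow> units a"
  by (auto simp: units_def ginv_def flip_def)

lemma big_unit_letter: "fst x \<in> hedges H \<Longrightarrow> rows True (fst x) = 1 \<Longrightarrow> \<not> big (unit_letter x)"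
  by (simp add: unit_letter_def)

lemma units_not_big: "units a \<Longrightarrow> x \<in> set a \<Longrightarrow> \<not> big (unit_letter x)"
  by (simp add: units_def big_unit_letter)

lemma deg_units [simp]: "units a \<Longrightarrow> deg (map unit_letter a) = 0"
  by (auto simp: deg_def units_not_big filter_empty_conv)

lemma not_bigE:
  assumes "z \<in> edge_gens" "\<not> big z"
  obtains x where "z = unit_letter x" "units [x]"
proof -
  obtain d h l r where z: "z = letter d h l r" "h \<in> hedges H" "l < rows d h" "r < rows (\<not> d) h"
    using assms(1) by (elim edge_gensE)
  then have 1: "rows True h = 1"
    using assms(2) sizes[of h] by auto
  then have "l = 0" "r = 0"
    using z unit_rows[of h d] unit_rows[of h "\<not> d"] by simp_all
  then show thesis
    using z 1 by (intro that[of "(h, d)"]) (simp_all add: unit_letter_def)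
qed

lemma forbidden_big_iff: "forbidden z z' \<Longrightarrow> big z \<longleftrightarrow> big z'"
  by (auto simp: forbidden_def)

lemma irred_units:
  assumes "irred (map unit_letter a)"
  shows "reduced a"
  using assms by (simp add: irred_def reduced_def successively_map)

lemma irred_map_unit_letter:
  assumes "reduced a" "units a"
  shows "irred (map unit_letter a)"
proof -
  have "unit_letter x \<in> edge_gens" if "x \<in> set a" for x
    using assms(2) that rows_pos by (auto simp: units_def unit_letter_def)
  then show ?thesis
    using assms(1) by (auto simp: irred_def reduced_def successively_map)
qed

section \<open>Products of irreducible words\<close>

lemma act_word_irred:
  assumes "irred (z # p)"
  shows "act_word z (p @ [Vert v]) = wv (z # p)"
proof -
  obtain d h l r where z: "z = letter d h l r" "h \<in> hedges H" "l < rows d h" "r < rows (\<not> d) h"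
    using assms by (auto simp: irred_Cons elim!: edge_gensE)
  have "normal (p @ [Vert v])"
    using assms by (simp add: normal_append_Vert irred_Cons)
  then have "start (hd (p @ [Vert v])) = row_verts (\<not> d) h ! r"
    using start_hd_normal row_verts_in_verts[OF z(2,4)] by (simp add: verts_eq)
  moreover have "\<not> forbidden z (hd (p @ [Vert v]))"
    using assms z(1) by (cases p) (auto simp: irred_Cons)
  ultimately show ?thesis
    by (simp add: z(1) act_letter_def)
qed

lemma foldr_act_irred:
  "irred (p @ q) \<Longrightarrow> foldr act p (wv q) = (wv (p @ q) :: (('v, 'e) lpa_gen, 'k::field) free)"
proof (induction p)
  case (Cons z p)
  moreover have "irred (p @ q)"
    using Cons.prems by (simp add: irred_Cons)
  ultimately show ?case
    by (simp add: act_word_irred[of z "p @ q", simplified])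
qed simp

text \<open>For a 1 by 1 hyperedge the sum in \<open>act_letter\<close> is empty, so rewriting is
  plain cancellation.\<close>

lemma foldr_act_units:
  assumes "units u"
  shows "foldr act (p @ map unit_letter u) (wv (map unit_letter (ginv u) @ q)) =
    (foldr act p (wv q) :: (('v, 'e) lpa_gen, 'k::field) free)"
  using assms
proof (induction u arbitrary: q rule: rev_induct)
  case (snoc x u)
  have "rows (snd x) (fst x) = 1" "rows (\<not> snd x) (fst x) = 1"
    using snoc.prems unit_rows by auto
  then have *: "act_word (unit_letter x) (unit_letter (flip x) # map unit_letter (ginv u) @ q @ [Vert v]) =
      wv (map unit_letter (ginv u) @ q)"
    by (simp add: unit_letter_def flip_def act_letter_forbidden)
  show ?case
    using snoc by (simp add: *)
qed simp

text \<open>Only the junction is reducible. The summands with k \<ge> 1 are irreducible; further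
  rewriting can occur only in the term where both letters disappear.\<close>

lemma foldr_act_forbidden:
  assumes "irred (p @ [letter d h l 0])" "irred (letter (\<not> d) h 0 r # q)"
  shows "foldr act (p @ [letter d h l 0]) (wv (letter (\<not> d) h 0 r # q)) =
    (if r = l then foldr act p (wv q) else 0) -
    (\<Sum>k\<in>{1..<rows (\<not> d) h}. wv (p @ [letter d h l k, letter (\<not> d) h k r] @ q) ::
      (('v, 'e) lpa_gen, 'k::field) free)"
proof -
  have irr: "irred (p @ [letter d h l k, letter (\<not> d) h k r] @ q)" if "k \<in> {1..<rows (\<not> d) h}" for k
  proof -
    have "\<not> forbidden (letter (\<not> d) h k r) z" if "\<not> forbidden (letter (\<not> d) h 0 r) z" for z
      using that by (auto simp: forbidden_def)
    moreover have "\<not> forbidden z (letter d h l k)" if "\<not> forbidden z (letter d h l 0)" for z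
      using that by (auto simp: forbidden_def)
    ultimately show ?thesis
      using assms that by (auto simp: irred_append irred_Cons)
  qed
  have *: "act_letter d h l 0 (letter (\<not> d) h 0 r # q @ [Vert v]) =
      (if r = l then wv q else 0) -
      (\<Sum>k\<in>{1..<rows (\<not> d) h}. wv (letter d h l k # letter (\<not> d) h k r # q))"
    by (simp add: act_letter_forbidden)
  have "foldr act (p @ [letter d h l 0]) (wv (letter (\<not> d) h 0 r # q)) =
      (foldr act p (act_letter d h l 0 (letter (\<not> d) h 0 r # q @ [Vert v])) ::
        (('v, 'e) lpa_gen, 'k) free)"
    by simp
  also have "\<dots> = (if r = l then foldr act p (wv q) else 0) -
      (\<Sum>k\<in>{1..<rows (\<not> d) h}. foldr act p (wv ([letter d h l k, letter (\<not> d) h k r] @ q)))"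
    unfolding * by (cases "r = l") (simp_all add: linear_map_simps[OF linear_map_foldr_act])
  also have "(\<Sum>k\<in>{1..<rows (\<not> d) h}. foldr act p (wv ([letter d h l k, letter (\<not> d) h k r] @ q))) =
      (\<Sum>k\<in>{1..<rows (\<not> d) h}.
        wv (p @ [letter d h l k, letter (\<not> d) h k r] @ q) :: (('v, 'e) lpa_gen, 'k) free)"
    by (intro sum.cong foldr_act_irred irr refl)
  finally show ?thesis .
qed

section \<open>The action in top degree\<close>

definition deg_le :: "nat \<Rightarrow> (('v, 'e) lpa_gen, 'k::field) free set" where
  "deg_le n = {g. \<forall>w\<in>Poly_Mapping.keys g. \<exists>p. letters w = p @ [Vert v] \<and> irred p \<and> deg p \<le> n}"

lemma deg_le_0: "0 \<in> deg_le n"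
  and deg_le_wv: "irred p \<Longrightarrow> deg p \<le> n \<Longrightarrow> wv p \<in> deg_le n"
  by (simp_all add: deg_le_def)

lemma deg_le_add: "f \<in> deg_le n \<Longrightarrow> g \<in> deg_le n \<Longrightarrow> f + g \<in> deg_le n"
  using Poly_Mapping.keys_add[of f g] by (fastforce simp: deg_le_def)

lemma deg_le_fscale: "f \<in> deg_le n \<Longrightarrow> fscale c f \<in> deg_le n"
  by (auto simp: deg_le_def in_keys_iff lookup_fscale)

lemma deg_le_diff: "f \<in> deg_le n \<Longrightarrow> g \<in> deg_le n \<Longrightarrow> f - g \<in> deg_le n"
  using deg_le_add[of f n "fscale (- 1) g"] deg_le_fscale[of g n "- 1"]
  by (simp add: fscale_uminus_one)

lemma deg_le_sum: "(\<And>x. x \<in> A \<Longrightarrow> u x \<in> deg_le n) \<Longrightarrow> sum u A \<in> deg_le n"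
  by (induction A rule: infinite_finite_induct) (auto simp: deg_le_0 intro: deg_le_add)

text \<open>Rewriting either keeps the hyperedges of both letters or deletes the letters, and
  deletion cannot raise the degree.\<close>

lemma act_word_deg_le:
  assumes "z \<in> edge_gens" "irred q" "deg q \<le> n"
  shows "act_word z (q @ [Vert v]) \<in> (deg_le (deg [z] + n) :: (('v, 'e) lpa_gen, 'k::field) free set)"
proof (cases "irred (z # q)")
  case True
  then show ?thesis
    using assms(3) by (simp only: act_word_irred) (rule deg_le_wv; simp)
next
  case False
  then obtain d h l r q' where z: "z = letter d h l 0" and q: "q = letter (\<not> d) h 0 r # q'"
    using assms by (cases q) (auto simp: irred_Cons forbidden_def)
  have irr: "irred (letter d h l k # letter (\<not> d) h k r # q')" if "k \<in> {1..<rows (\<not> d) h}" for k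
  proof -
    have "\<not> forbidden (letter (\<not> d) h k r) z" if "\<not> forbidden (letter (\<not> d) h 0 r) z" for z
      using that by (auto simp: forbidden_def)
    then show ?thesis
      using assms z q that by (auto simp: irred_Cons)
  qed
  have "act_word z (q @ [Vert v]) = (if r = l then wv q' else 0) -
      (\<Sum>k\<in>{1..<rows (\<not> d) h}. wv (letter d h l k # letter (\<not> d) h k r # q') ::
        (('v, 'e) lpa_gen, 'k) free)"
    by (simp add: z q act_letter_forbidden)
  moreover have "(if r = l then wv q' else 0 :: (('v, 'e) lpa_gen, 'k) free) \<in> deg_le (deg [z] + n)"
    using assms by (auto simp: q irred_Cons intro!: deg_le_wv deg_le_0)
  moreover have "(\<Sum>k\<in>{1..<rows (\<not> d) h}. wv (letter d h l k # letter (\<not> d) h k r # q'))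
      \<in> (deg_le (deg [z] + n) :: (('v, 'e) lpa_gen, 'k) free set)"
    using assms(3) by (intro deg_le_sum deg_le_wv irr) (auto simp: z q)
  ultimately show ?thesis
    by (simp only: deg_le_diff)
qed

lemma act_deg_le:
  assumes "z \<in> edge_gens" "g \<in> deg_le n"
  shows "act z g \<in> deg_le (deg [z] + n)"
proof -
  have "act z (wd (letters w)) \<in> deg_le (deg [z] + n)" if w: "w \<in> Poly_Mapping.keys g" for w
  proof -
    obtain p where "letters w = p @ [Vert v]" "irred p" "deg p \<le> n"
      using assms(2) w by (auto simp: deg_le_def)
    then show ?thesis
      by (simp only: act_wd act_word_deg_le[OF assms(1)])
  qed
  then show ?thesis
    unfolding linear_map_expand[OF linear_map_act, of z g] by (intro deg_le_sum deg_le_fscale)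
qed

lemma foldr_act_deg_le:
  "set p \<subseteq> edge_gens \<Longrightarrow> g \<in> deg_le n \<Longrightarrow> foldr act p g \<in> deg_le (deg p + n)"
proof (induction p)
  case (Cons z p)
  then have "act z (foldr act p g) \<in> deg_le (deg [z] + (deg p + n))"
    by (intro act_deg_le) auto
  then show ?case
    by (simp add: add.assoc)
qed simp

text \<open>The argument \<open>K\<close> only fixes the field of the structure constants.\<close>

definition coef :: "'k itself \<Rightarrow> ('v, 'e) lpa_gen list \<Rightarrow> ('v, 'e) lpa_gen list \<Rightarrow>
    ('v, 'e) lpa_gen list \<Rightarrow> 'k::field" where
  "coef K p q w = Poly_Mapping.lookup (foldr act p (wv q)) (Word (w @ [Vert v]))"

lemma lookup_wv: "Poly_Mapping.lookup (wv p) (Word (w @ [Vert v])) = (if p = w then 1 else 0)"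
  by (simp add: lookup_single when_def)

lemma lookup_deg_le:
  assumes "g \<in> deg_le n" "n < deg w"
  shows "Poly_Mapping.lookup g (Word (w @ [Vert v])) = 0"
proof (rule ccontr)
  assume "\<not> ?thesis"
  then have "Word (w @ [Vert v]) \<in> Poly_Mapping.keys g"
    by (simp add: in_keys_iff)
  then show False
    using assms by (force simp: deg_le_def)
qed

lemma coef_deg:
  fixes K :: "'k::field itself"
  assumes "irred p" "irred q" "coef K p q w \<noteq> 0"
  shows "deg w \<le> deg p + deg q"
proof (rule ccontr)
  assume "\<not> deg w \<le> deg p + deg q"
  moreover have "foldr act p (wv q) \<in> (deg_le (deg p + deg q) :: (('v, 'e) lpa_gen, 'k) free set)"
    using assms by (intro foldr_act_deg_le deg_le_wv) (auto simp: irred_def)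
  ultimately have "coef K p q w = 0"
    unfolding coef_def by (intro lookup_deg_le) auto
  then show False
    using assms(3) by simp
qed

text \<open>The term in which both letters disappear has degree at most
  \<open>deg p + deg q\<close>, too small for \<open>w\<close>.\<close>

lemma coef_forbidden:
  fixes K :: "'k::field itself"
  assumes "irred (p @ [letter d h l 0])" "irred (letter (\<not> d) h 0 r # q)" "deg p + deg q < deg w"
  shows "coef K (p @ [letter d h l 0]) (letter (\<not> d) h 0 r # q) w =
    - (\<Sum>k\<in>{1..<rows (\<not> d) h}. if p @ [letter d h l k, letter (\<not> d) h k r] @ q = w then 1 else 0)"
proof -
  have "set p \<subseteq> edge_gens" "irred q"
    using assms(1,2) by (auto simp: irred_append irred_Cons irred_def[of p])
  then have "foldr act p (wv q) \<in> (deg_le (deg p + deg q) :: (('v, 'e) lpa_gen, 'k) free set)"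
    by (intro foldr_act_deg_le deg_le_wv) auto
  from lookup_deg_le[OF this assms(3)]
  show ?thesis
    unfolding coef_def foldr_act_forbidden[OF assms(1,2)] lookup_minus lookup_sum lookup_wv
    by simp
qed

text \<open>Unit letters at the junction cancel without changing the degree. When two forbidden big
  letters meet, the term deleting them has too small a degree, so rewriting ends with this
  step.\<close>

lemma coef_nonzero_cases:
  fixes K :: "'k::field itself"
  assumes "irred p" "irred q" "coef K p q w \<noteq> 0" "deg p + deg q \<le> deg w"
  shows "\<exists>u p1 q1. p = p1 @ map unit_letter u \<and> q = map unit_letter (ginv u) @ q1 \<and> units u \<and>
    (w = p1 @ q1 \<or> (\<exists>p2 d h l r q2 k. p1 = p2 @ [letter d h l 0] \<and> q1 = letter (\<not> d) h 0 r # q2 \<and>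
      rows True h \<ge> 2 \<and> 1 \<le> k \<and> w = p2 @ [letter d h l k, letter (\<not> d) h k r] @ q2))"
  using assms
proof (induction p arbitrary: q rule: rev_induct)
  case Nil
  then have "w = q"
    by (auto simp: coef_def lookup_wv split: if_splits)
  then show ?case
    by (intro exI[of _ "[]"] exI[of _ q]) simp
next
  case (snoc z p)
  show ?case
  proof (cases "irred ((p @ [z]) @ q)")
    case True
    have "w = (p @ [z]) @ q"
      using snoc.prems(3) unfolding coef_def foldr_act_irred[OF True] lookup_wv
      by (simp split: if_splits)
    then show ?thesis
      by (intro exI[of _ "[]"] exI[of _ "p @ [z]"] exI[of _ q]) simp
  next
    case False
    then obtain d h l r q' where z: "z = letter d h l 0" and q: "q = letter (\<not> d) h 0 r # q'"
      using snoc.prems(1,2) by (cases q) (auto simp: irred_append irred_Cons forbidden_def)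
    show ?thesis
    proof (cases "big z")
      case True
      then have *: "coef K (p @ [z]) q w =
          - (\<Sum>k\<in>{1..<rows (\<not> d) h}. if p @ [letter d h l k, letter (\<not> d) h k r] @ q' = w then 1 else 0)"
        using snoc.prems unfolding z q by (intro coef_forbidden) auto
      have "\<exists>k\<in>{1..<rows (\<not> d) h}. p @ [letter d h l k, letter (\<not> d) h k r] @ q' = w"
      proof (rule ccontr)
        assume "\<not> ?thesis"
        then have "coef K (p @ [z]) q w = 0"
          unfolding * by (subst sum.neutral) auto
        then show False
          using snoc.prems(3) by simp
      qed
      then show ?thesis
        using True z q by (intro exI[of _ "[]"] exI[of _ "p @ [z]"] exI[of _ q]) fastforce
    next
      case False
      have "z \<in> edge_gens"
        using snoc.prems(1) by (simp add: irred_append irred_Cons)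
      then obtain x where x: "z = unit_letter x" "units [x]"
        using False by (rule not_bigE)
      \<comment> \<open>The forbidden partner belongs to the same 1 by 1 hyperedge, so its right
        index is 0 as well.\<close>
      have q2: "q = unit_letter (flip x) # q'"
      proof -
        have "letter (\<not> d) h 0 r \<in> edge_gens"
          using snoc.prems(2) q by (simp add: irred_Cons)
        moreover have "h = fst x" "d = snd x"
          using x(1) z by (auto simp: unit_letter_def)
        moreover have "rows d h = 1"
          using x(2) unit_rows[of h d] calculation by auto
        ultimately show ?thesis
          using q by (simp add: unit_letter_def flip_def)
      qed
      have "coef K (p @ [z]) q w = coef K p q' w"
        using foldr_act_units[OF x(2), where 'k = 'k, of p q'] by (simp add: coef_def x(1) q2)
      then have IH_prems: "irred p" "irred q'" "coef K p q' w \<noteq> 0" "deg p + deg q' \<le> deg w"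
        using snoc.prems q by (simp_all add: irred_append irred_Cons)
      obtain u p1 q1 where u: "p = p1 @ map unit_letter u" "q' = map unit_letter (ginv u) @ q1" "units u"
        "w = p1 @ q1 \<or> (\<exists>p2 d h l r q2 k. p1 = p2 @ [letter d h l 0] \<and> q1 = letter (\<not> d) h 0 r # q2 \<and>
          rows True h \<ge> 2 \<and> 1 \<le> k \<and> w = p2 @ [letter d h l k, letter (\<not> d) h k r] @ q2)"
        using snoc.IH[OF IH_prems] by (elim exE conjE) (rule that)
      show ?thesis
        using u x q2 by (intro exI[of _ "u @ [x]"] exI[of _ p1] exI[of _ q1]) simp
    qed
  qed
qed

section \<open>Words cut at their last or first big letter\<close>

definition stem :: "('v, 'e) lpa_gen list \<Rightarrow> bool" where
  "stem A \<longleftrightarrow> irred A \<and> (A = [] \<or> big (last A))"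

definition costem :: "('v, 'e) lpa_gen list \<Rightarrow> bool" where
  "costem B \<longleftrightarrow> irred B \<and> (B = [] \<or> big (hd B))"

text \<open>Collects the unit letters behind the last big letter into a group word. With
  \<open>costem_exists\<close>, a product takes the form stem, group element, costem.\<close>

lemma stem_exists:
  assumes "irred p"
  obtains A a where "p = A @ map unit_letter a" "stem A" "units a"
  using assms
proof (induction p arbitrary: thesis rule: rev_induct)
  case Nil
  then show ?case
    by (metis append_Nil list.simps(8) stem_def irred_Nil units_simps(1))
next
  case (snoc z p)
  show ?case
  proof (cases "big z")
    case True
    then show ?thesis
      using snoc.prems by (intro snoc.prems(1)[of "p @ [z]" "[]"]) (auto simp: stem_def)
  next
    case False
    have "z \<in> edge_gens"
      using snoc.prems(2) by (simp add: irred_append irred_Cons)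
    then obtain x where x: "z = unit_letter x" "units [x]"
      using False by (rule not_bigE)
    obtain A a where "p = A @ map unit_letter a" "stem A" "units a"
      using snoc.IH snoc.prems(2) by (auto simp: irred_append)
    then show ?thesis
      using x by (intro snoc.prems(1)[of A "a @ [x]"]) auto
  qed
qed

lemma costem_exists:
  assumes "irred q"
  obtains b B where "q = map unit_letter b @ B" "costem B" "units b"
  using assms
proof (induction q arbitrary: thesis)
  case Nil
  then show ?case
    by (metis append_Nil list.simps(8) costem_def irred_Nil units_simps(1))
next
  case (Cons z q)
  show ?case
  proof (cases "big z")
    case True
    then show ?thesis
      using Cons.prems by (intro Cons.prems(1)[of "[]" "z # q"]) (auto simp: costem_def)
  next
    case False
    have "z \<in> edge_gens"
      using Cons.prems(2) by (simp add: irred_Cons)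
    then obtain x where x: "z = unit_letter x" "units [x]"
      using False by (rule not_bigE)
    obtain b B where "q = map unit_letter b @ B" "costem B" "units b"
      using Cons.IH Cons.prems(2) by (auto simp: irred_Cons)
    then show ?thesis
      using x by (intro Cons.prems(1)[of "x # b" B]) auto
  qed
qed

text \<open>Forbidden letters share their hyperedge, so a big and a unit letter never form such a
  pair; \<open>A\<close> and \<open>B\<close> touch only if \<open>g\<close> is empty.\<close>

lemma irred_sandwich:
  assumes "stem A" "costem B" "reduced g" "units g"
    "g = [] \<Longrightarrow> A = [] \<or> B = [] \<or> \<not> forbidden (last A) (hd B)"
  shows "irred (A @ map unit_letter g @ B)"
proof (cases "g = []")
  case True
  then show ?thesis
    using assms by (auto simp: irred_append stem_def costem_def)
next
  case False
  have "\<not> big (unit_letter (hd g))" "\<not> big (unit_letter (last g))"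
    using False assms(4) by (simp_all add: units_not_big)
  then have "A = [] \<or> \<not> forbidden (last A) (unit_letter (hd g))"
    "B = [] \<or> \<not> forbidden (unit_letter (last g)) (hd B)"
    using assms(1,2) forbidden_big_iff by (auto simp: stem_def costem_def)
  then show ?thesis
    using False assms irred_map_unit_letter[OF assms(3,4)]
    by (auto simp: irred_append stem_def costem_def hd_map last_map hd_append)
qed

lemma deg_pos: "z \<in> set p \<Longrightarrow> big z \<Longrightarrow> deg p > 0"
  by (auto simp: deg_def filter_empty_conv)

text \<open>The degree locates the cut: moving it into \<open>A\<close> loses the big last letter of
  \<open>A\<close>, moving it into \<open>B\<close> gains the big first letter of
  \<open>B\<close>.\<close>

lemma sandwich_split:
  assumes "stem A" "costem B" "units g" "A @ map unit_letter g @ B = p @ q" "deg p = deg A"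
  obtains g1 g2 where "p = A @ map unit_letter g1" "q = map unit_letter g2 @ B" "g = g1 @ g2"
proof -
  from assms(4) consider us where "A = p @ us" "us @ map unit_letter g @ B = q"
    | us where "p = A @ us" "map unit_letter g @ B = us @ q"
    by (auto simp: append_eq_append_conv2)
  then show thesis
  proof cases
    case 1
    have "us = []"
      using assms(1,5) deg_pos[of "last us" us] by (cases "us = []") (auto simp: 1(1) stem_def)
    then show thesis
      using 1 by (intro that[of "[]" g]) auto
  next
    case 2
    from 2(2) consider vs where "map unit_letter g = us @ vs" "vs @ B = q"
      | vs where "us = map unit_letter g @ vs" "B = vs @ q"
      by (auto simp: append_eq_append_conv2)
    then show thesis
    proof cases
      case (1 vs)
      then obtain g1 g2 where "g = g1 @ g2" "us = map unit_letter g1" "vs = map unit_letter g2"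
        by (auto simp: map_eq_append_conv)
      then show thesis
        using 1 2 by (intro that[of g1 g2]) auto
    next
      case (2 vs)
      have "vs = []"
        using assms(2,3,5) deg_pos[of "hd vs" vs]
        by (cases "vs = []") (auto simp: 2 \<open>p = A @ us\<close> costem_def)
      then show thesis
        using 2 \<open>p = A @ us\<close> by (intro that[of g "[]"]) auto
    qed
  qed
qed

lemma coef_sandwich_cases:
  assumes "stem A" "costem B" "units g" "irred p" "irred q" "deg p \<le> deg A" "deg q \<le> deg B"
    and nz: "coef K p q (A @ map unit_letter g @ B) \<noteq> 0"
  obtains
    (product) a b where "p = A @ map unit_letter a" "q = map unit_letter b @ B"
      "units a" "units b" "ev (a @ b) = ev g"
  | (forbidden) p2 d h l r q2 k u where "g = []" "A = p2 @ [letter d h l k]"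
      "B = letter (\<not> d) h k r # q2" "k \<ge> 1" "units u"
      "p = p2 @ [letter d h l 0] @ map unit_letter u"
      "q = map unit_letter (ginv u) @ [letter (\<not> d) h 0 r] @ q2"
proof -
  let ?w = "A @ map unit_letter g @ B"
  \<comment> \<open>The degree never increases, so the assumed bounds on \<open>deg p\<close> and
    \<open>deg q\<close> are equalities.\<close>
  have "deg A + deg B \<le> deg p + deg q"
    using coef_deg[OF assms(4,5) nz] assms(3) by simp
  then have deg: "deg p = deg A" "deg q = deg B" "deg p + deg q \<le> deg ?w"
    using assms(3,6,7) by simp_all
  obtain u p1 q1 where u: "p = p1 @ map unit_letter u" "q = map unit_letter (ginv u) @ q1" "units u"
    and cases: "?w = p1 @ q1 \<or> (\<exists>p2 d h l r q2 k. p1 = p2 @ [letter d h l 0] \<and>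
      q1 = letter (\<not> d) h 0 r # q2 \<and> rows True h \<ge> 2 \<and> 1 \<le> k \<and>
      ?w = p2 @ [letter d h l k, letter (\<not> d) h k r] @ q2)"
    using coef_nonzero_cases[OF assms(4,5) nz deg(3)] by (elim exE conjE) (rule that)
  have deg1: "deg p1 = deg A"
    using u(1,3) deg(1) by simp
  from cases show thesis
  proof (elim disjE exE conjE)
    assume "?w = p1 @ q1"
    from sandwich_split[OF assms(1-3) this deg1]
    obtain g1 g2 where g: "p1 = A @ map unit_letter g1" "q1 = map unit_letter g2 @ B" "g = g1 @ g2" .
    have "ev ((g1 @ u) @ ginv u @ g2) = ev g"
      by (simp only: ev_cancel g(3))
    then show thesis
      using g u assms(3) by (intro product[of "g1 @ u" "ginv u @ g2"]) simp_all
  next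
    fix p2 d h l r q2 k
    assume *: "p1 = p2 @ [letter d h l 0]" "q1 = letter (\<not> d) h 0 r # q2" "rows True h \<ge> 2" "1 \<le> k"
      "?w = p2 @ [letter d h l k, letter (\<not> d) h k r] @ q2"
    have "?w = (p2 @ [letter d h l k]) @ letter (\<not> d) h k r # q2" "deg (p2 @ [letter d h l k]) = deg A"
      using * deg1 by simp_all
    from sandwich_split[OF assms(1-3) this]
    obtain g1 g2 where g: "p2 @ [letter d h l k] = A @ map unit_letter g1"
      "letter (\<not> d) h k r # q2 = map unit_letter g2 @ B" "g = g1 @ g2" .
    \<comment> \<open>The letters on both sides of the cut are big and cannot belong to the unit
      part, which is therefore empty.\<close>
    have "g1 = []"
    proof (rule ccontr)
      assume "g1 \<noteq> []"
      then have "(letter d h l k :: ('v, 'e) lpa_gen) = unit_letter (last g1)"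
        using arg_cong[OF g(1), of last] by (simp add: last_map)
      moreover have "\<not> big (unit_letter (last g1))"
        using \<open>g1 \<noteq> []\<close> g(3) assms(3) by (intro units_not_big[of g1]) auto
      ultimately show False
        using *(3) by (metis big_letter)
    qed
    moreover have "g2 = []"
    proof (rule ccontr)
      assume "g2 \<noteq> []"
      then have "(letter (\<not> d) h k r :: ('v, 'e) lpa_gen) = unit_letter (hd g2)"
        using arg_cong[OF g(2), of hd] by (simp add: hd_map)
      moreover have "\<not> big (unit_letter (hd g2))"
        using \<open>g2 \<noteq> []\<close> g(3) assms(3) by (intro units_not_big[of g2]) auto
      ultimately show False
        using *(3) by (metis big_letter)
    qed
    ultimately show thesis
      using g * u by (intro forbidden[of p2 d h l k r q2 u]) auto
  qed
qed

text \<open>At such a \<open>w\<close>, a product of elements with supports \<open>FS\<close> and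
  \<open>GS\<close> has only one nonzero contribution, so nothing can cancel it.\<close>

definition isolated where
  "isolated K FS GS p q w \<longleftrightarrow> p \<in> FS \<and> q \<in> GS \<and> coef K p q w \<noteq> 0 \<and>
    (\<forall>p'\<in>FS. \<forall>q'\<in>GS. coef K p' q' w \<noteq> 0 \<longrightarrow> p' = p \<and> q' = q)"

text \<open>The common inner index \<open>k\<close> is arbitrary: besides the forbidden case k = 0
  this covers the words that rewriting produces.\<close>

definition opposite :: "('v, 'e) lpa_gen list \<Rightarrow> ('v, 'e) lpa_gen list \<Rightarrow> bool" where
  "opposite A B \<longleftrightarrow> (\<exists>p2 d h l r q2 k. A = p2 @ [letter d h l k] \<and> B = letter (\<not> d) h k r # q2)"

end

section \<open>Isolated words for two finite supports\<close>

locale one_vertex_supports = one_vertex_hypergraph H S R v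
  for H :: "('v, 'e) hypergraph" and S R v +
  fixes K :: "'k::field itself"
    and FS GS :: "('v, 'e) lpa_gen list set"
    and m n :: nat
  assumes finite_supports: "finite FS" "finite GS"
    and irred_supports: "p \<in> FS \<Longrightarrow> irred p" "q \<in> GS \<Longrightarrow> irred q"
    and deg_supports: "p \<in> FS \<Longrightarrow> deg p \<le> m" "q \<in> GS \<Longrightarrow> deg q \<le> n"
begin

text \<open>The support of the group ring element that stands behind the stem
  \<open>A\<close>.\<close>

definition right_part :: "('v, 'e) lpa_gen list \<Rightarrow> ('e \<times> bool) list set" where
  "right_part A = {a. A @ map unit_letter a \<in> FS \<and> units a}"

definition left_part :: "('v, 'e) lpa_gen list \<Rightarrow> ('e \<times> bool) list set" where
  "left_part B = {b. map unit_letter b @ B \<in> GS \<and> units b}"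

lemma irred_right_part: "right_part A \<noteq> {} \<Longrightarrow> irred A"
  and irred_left_part: "left_part B \<noteq> {} \<Longrightarrow> irred B"
  by (auto simp: right_part_def left_part_def irred_append dest!: irred_supports)

lemma inj_map_unit_letter: "map unit_letter a = map unit_letter b \<longleftrightarrow> a = b"
  by (rule inj_map_eq_map[OF inj_unit_letter])

lemma unique_product:
  assumes "right_part A \<noteq> {}" "left_part B \<noteq> {}"
  obtains a u b where "a @ u \<in> right_part A" "ginv u @ b \<in> left_part B" "reduced (a @ b)"
    "\<forall>a'\<in>right_part A. \<forall>b'\<in>left_part B. ev (a' @ b') = ev (a @ b) \<longrightarrow> a' = a @ u \<and> b' = ginv u @ b"
proof -
  have "right_part A \<subseteq> (\<lambda>a. A @ map unit_letter a) -` FS"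
    "left_part B \<subseteq> (\<lambda>b. map unit_letter b @ B) -` GS"
    by (auto simp: right_part_def left_part_def)
  then have fin: "finite (right_part A)" "finite (left_part B)"
    using finite_supports
    by (auto intro!: finite_vimageI injI simp: inj_map_unit_letter elim!: finite_subset)
  have red: "reduced x" if "x \<in> right_part A \<union> left_part B" for x
  proof -
    have "irred (map unit_letter x)"
      using that by (auto simp: right_part_def left_part_def irred_append dest!: irred_supports)
    then show ?thesis
      by (rule irred_units)
  qed
  obtain a b where ab: "a \<in> right_part A" "b \<in> left_part B"
    "\<And>a' b'. a' \<in> right_part A \<Longrightarrow> b' \<in> left_part B \<Longrightarrow> ev (a' @ b') = ev (a @ b) \<Longrightarrow>
      a' = a \<and> b' = b"
    using free_group_unique_product[OF fin(1) assms(1) fin(2) assms(2) red] by metis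
  obtain a1 u b1 where u: "a = a1 @ u" "b = ginv u @ b1" "reduced (a1 @ b1)"
    using reduced_product red ab by (metis UnI1 UnI2)
  show thesis
  proof (rule that[of a1 u b1])
    show "\<forall>a'\<in>right_part A. \<forall>b'\<in>left_part B. ev (a' @ b') = ev (a1 @ b1) \<longrightarrow>
        a' = a1 @ u \<and> b' = ginv u @ b1"
      using ab(3) unfolding u(1,2) ev_cancel by blast
  qed (use ab(1,2) u in simp_all)
qed

text \<open>By \<open>coef_sandwich_cases\<close> a pair contributes either through the group
  product, which is unique, or through a rewritten forbidden pair, which \<open>no_forbidden\<close>
  excludes.\<close>

lemma isolated_product:
  assumes "stem A" "costem B" "deg A = m" "deg B = n"
    and au: "a @ u \<in> right_part A" and ub: "ginv u @ b \<in> left_part B" and "reduced (a @ b)"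
    and uniq: "\<forall>a'\<in>right_part A. \<forall>b'\<in>left_part B. ev (a' @ b') = ev (a @ b) \<longrightarrow>
      a' = a @ u \<and> b' = ginv u @ b"
    and "a @ b = [] \<Longrightarrow> A = [] \<or> B = [] \<or> \<not> forbidden (last A) (hd B)"
    and no_forbidden: "\<And>p2 d h l r q2 k u'. a @ b = [] \<Longrightarrow> A = p2 @ [letter d h l k] \<Longrightarrow>
      B = letter (\<not> d) h k r # q2 \<Longrightarrow> k \<ge> 1 \<Longrightarrow> units u' \<Longrightarrow>
      p2 @ [letter d h l 0] @ map unit_letter u' \<notin> FS"
  shows "isolated K FS GS (A @ map unit_letter (a @ u)) (map unit_letter (ginv u @ b) @ B)
    (A @ map unit_letter (a @ b) @ B)"
proof -
  have units: "units a" "units b" "units u"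
    using au ub by (auto simp: right_part_def left_part_def)
  have irr: "irred (A @ map unit_letter (a @ b) @ B)"
    by (rule irred_sandwich[OF assms(1,2,7) _ assms(9)]) (simp_all add: units)
  have "foldr act (A @ map unit_letter (a @ u)) (wv (map unit_letter (ginv u @ b) @ B)) =
      (wv (A @ map unit_letter (a @ b) @ B) :: (('v, 'e) lpa_gen, 'k) free)"
    using foldr_act_units[OF units(3), where 'k = 'k,
        of "A @ map unit_letter a" "map unit_letter b @ B"]
      foldr_act_irred[where 'k = 'k, of "A @ map unit_letter a" "map unit_letter b @ B"] irr
    by simp
  then have "coef K (A @ map unit_letter (a @ u)) (map unit_letter (ginv u @ b) @ B)
      (A @ map unit_letter (a @ b) @ B) = 1"
    unfolding coef_def by (simp only: lookup_wv) simp
  moreover have "p' = A @ map unit_letter (a @ u) \<and> q' = map unit_letter (ginv u @ b) @ B"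
    if pq: "p' \<in> FS" "q' \<in> GS" and nz: "coef K p' q' (A @ map unit_letter (a @ b) @ B) \<noteq> 0" for p' q'
  proof -
    have "units (a @ b)" "deg p' \<le> deg A" "deg q' \<le> deg B"
      using units deg_supports pq assms by auto
    from assms(1,2) this(1) irred_supports(1)[OF pq(1)] irred_supports(2)[OF pq(2)] this(2,3) nz
    show ?thesis
    proof (cases rule: coef_sandwich_cases)
      case (product a' b')
      then have "a' \<in> right_part A" "b' \<in> left_part B"
        using pq by (auto simp: right_part_def left_part_def)
      then show ?thesis
        using uniq product by metis
    next
      case (forbidden p2 d h l r q2 k u')
      then show ?thesis
        using no_forbidden pq(1) by blast
    qed
  qed
  ultimately show ?thesis
    using au ub by (auto simp: isolated_def right_part_def left_part_def)
qed

lemma isolated_not_opposite: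
  assumes "stem A" "costem B" "deg A = m" "deg B = n" "right_part A \<noteq> {}" "left_part B \<noteq> {}"
    "\<not> opposite A B"
  shows "\<exists>p q w. isolated K FS GS p q w"
proof -
  obtain a u b where *: "a @ u \<in> right_part A" "ginv u @ b \<in> left_part B" "reduced (a @ b)"
    "\<forall>a'\<in>right_part A. \<forall>b'\<in>left_part B. ev (a' @ b') = ev (a @ b) \<longrightarrow> a' = a @ u \<and> b' = ginv u @ b"
    by (rule unique_product[OF assms(5,6)]) (rule that)
  have "A = [] \<or> B = [] \<or> \<not> forbidden (last A) (hd B)"
    using assms(7) unfolding opposite_def forbidden_def
    by (metis append_butlast_last_id list.collapse)
  then have "isolated K FS GS (A @ map unit_letter (a @ u)) (map unit_letter (ginv u @ b) @ B)
      (A @ map unit_letter (a @ b) @ B)"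
    by (rule isolated_product[OF assms(1-4) *]) (use assms(7) in \<open>auto simp: opposite_def\<close>)
  then show ?thesis
    by blast
qed

text \<open>
  A nonzero tensor of rank one with nonzero entry at $(k, k)$ either has a nonzero entry off the
  diagonal or is a multiple of $e_k \otimes e_k$. In the latter case $e_k \otimes e_k$ survives,
  unless \<open>k\<close> is the first index; then rewriting it produces $e_{k+1} \otimes e_{k+1}$.
\<close>

lemma isolated_opposite:
  fixes d h l k r p2 q2
  defines "A \<equiv> \<lambda>k. p2 @ [letter d h l k]" and "B \<equiv> \<lambda>k. letter (\<not> d) h k r # q2"
  assumes stems: "stem (A k)" "costem (B k)" "deg (A k) = m" "deg (B k) = n"
    and ne: "right_part (A k) \<noteq> {}" "left_part (B k) \<noteq> {}"
  shows "\<exists>p q w. isolated K FS GS p q w"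
proof -
  have h: "h \<in> hedges H" "l < rows d h" "k < rows (\<not> d) h" "rows (\<not> d) h \<ge> 2" "r < rows d h"
    and big: "rows True h \<ge> 2"
    using stems(1,2) big_rows[of h "\<not> d"]
    by (auto simp: A_def B_def stem_def costem_def irred_append irred_Cons)
  have stemA: "stem (A k')" if "irred (A k')" for k'
    using that big by (simp add: stem_def A_def)
  have costemB: "costem (B k')" if "irred (B k')" for k'
    using that big by (simp add: costem_def B_def)
  have degs: "deg (A k') = m" "deg (B k') = n" for k'
    using stems(3,4) by (simp_all add: A_def B_def)
  show ?thesis
  \<comment> \<open>The sets \<open>right_part (A k')\<close> and \<open>left_part (B k')\<close>
    play the entries of the two vectors; the first case is a nonzero entry off the diagonal.\<close>
  proof (cases "\<exists>k'. k' \<noteq> k \<and> (right_part (A k') \<noteq> {} \<or> left_part (B k') \<noteq> {})")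
    case True
    then obtain k' where k': "k' \<noteq> k" "right_part (A k') \<noteq> {} \<or> left_part (B k') \<noteq> {}"
      by blast
    then show ?thesis
    proof (elim disjE)
      assume ne': "right_part (A k') \<noteq> {}"
      then have "irred (A k')"
        by (rule irred_right_part)
      moreover have "\<not> opposite (A k') (B k)"
        using k'(1) by (auto simp: opposite_def A_def B_def)
      ultimately show ?thesis
        using isolated_not_opposite[OF stemA stems(2) degs(1) stems(4) ne' ne(2)] by blast
    next
      assume ne': "left_part (B k') \<noteq> {}"
      then have "irred (B k')"
        by (rule irred_left_part)
      moreover have "\<not> opposite (A k) (B k')"
        using k'(1) by (auto simp: opposite_def A_def B_def)
      ultimately show ?thesis
        using isolated_not_opposite[OF stems(1) costemB stems(3) degs(2) ne(1) ne'] by blast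
    qed
  next
    case False
    then have empty: "right_part (A k') = {}" "left_part (B k') = {}" if "k' \<noteq> k" for k'
      using that by auto
    obtain a u b where au: "a @ u \<in> right_part (A k)" and ub: "ginv u @ b \<in> left_part (B k)"
      and red: "reduced (a @ b)"
      and uniq: "\<forall>a'\<in>right_part (A k). \<forall>b'\<in>left_part (B k). ev (a' @ b') = ev (a @ b) \<longrightarrow>
        a' = a @ u \<and> b' = ginv u @ b"
      by (rule unique_product[OF ne]) (rule that)
    show ?thesis
    proof (cases "a @ b = [] \<and> k = 0")
      \<comment> \<open>Either \<open>a @ b\<close> keeps the big letters apart, or k \<ge> 1 and
        any word rewritten to this one has inner index 0, excluded by \<open>empty\<close>.\<close>
      case False
      have no_forbidden: "p2 @ [letter d h l 0] @ map unit_letter u' \<notin> FS"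
        if "k \<ge> 1" "units u'" for u'
        using empty(1)[of 0] that by (auto simp: right_part_def A_def)
      have "isolated K FS GS (A k @ map unit_letter (a @ u)) (map unit_letter (ginv u @ b) @ B k)
          (A k @ map unit_letter (a @ b) @ B k)"
        by (rule isolated_product[OF stems au ub red uniq])
          (use False no_forbidden in \<open>auto simp: A_def B_def\<close>)
      then show ?thesis
        by blast
    next
      case True
      then have k: "a = []" "b = []" "k = 0"
        by simp_all
      \<comment> \<open>Index 1 exists because \<open>rows (\<not> d) h \<ge> 2\<close>; rewriting
        the forbidden pair gives this word the coefficient -1.\<close>
      let ?w = "A 1 @ map unit_letter [] @ B 1"
      have irr: "irred (p2 @ [letter d h l 0])" "irred (letter (\<not> d) h 0 r # q2)"
        using stems(1,2) k(3) by (simp_all add: A_def B_def stem_def costem_def)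
      have "irred (A 1)" "irred (B 1)"
        using irr h by (auto simp: A_def B_def irred_append irred_Cons forbidden_def)
      note stems1 = stemA[OF this(1)] costemB[OF this(2)]
      have "coef K (A 0 @ map unit_letter u) (map unit_letter (ginv u) @ B 0) ?w =
          coef K (p2 @ [letter d h l 0]) (letter (\<not> d) h 0 r # q2) ?w"
        using au foldr_act_units[where 'k = 'k, of u "p2 @ [letter d h l 0]" "letter (\<not> d) h 0 r # q2"]
        by (simp add: coef_def A_def B_def k right_part_def)
      also have "\<dots> = - (\<Sum>k\<in>{1..<rows (\<not> d) h}. if k = 1 then 1 else 0)"
        using big by (subst coef_forbidden[OF irr]) (simp_all add: A_def B_def cong: conj_cong)
      also have "\<dots> = - 1"
        using h(4) by simp
      finally have nz: "coef K (A 0 @ map unit_letter u) (map unit_letter (ginv u) @ B 0) ?w \<noteq> 0"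
        by simp
      moreover have "p' = A 0 @ map unit_letter u \<and> q' = map unit_letter (ginv u) @ B 0"
        if pq: "p' \<in> FS" "q' \<in> GS" and nz: "coef K p' q' ?w \<noteq> 0" for p' q'
      proof -
        have "deg p' \<le> deg (A 1)" "deg q' \<le> deg (B 1)"
          using deg_supports pq degs by auto
        from stems1 units_simps(1) irred_supports(1)[OF pq(1)] irred_supports(2)[OF pq(2)] this nz
        show ?thesis
        proof (cases rule: coef_sandwich_cases)
          \<comment> \<open>Such a pair needs a word of \<open>FS\<close> with inner index 1, and
            there is none.\<close>
          case (product a' b')
          then show ?thesis
            using empty(1)[of 1] pq k by (auto simp: right_part_def)
        next
          case (forbidden p2' d' h' l' r' q2' k' u')
          then have *: "p' = A 0 @ map unit_letter u'" "q' = map unit_letter (ginv u') @ B 0"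
            by (simp_all add: A_def B_def)
          then have "u' \<in> right_part (A 0)" "ginv u' \<in> left_part (B 0)"
            using pq[unfolded *] forbidden(5) by (simp_all add: right_part_def left_part_def)
          \<comment> \<open>Both sides are trivial in the group, so uniqueness of the product
            \<open>a @ b\<close> identifies \<open>u'\<close> with \<open>u\<close>.\<close>
          moreover have "ev (u' @ ginv u') = ev (a @ b)"
            using ev_cancel[of "[]" u' "[]"] k by simp
          ultimately have "u' = u"
            using uniq k by auto
          then show ?thesis
            using * by simp
        qed
      qed
      ultimately have "isolated K FS GS (A 0 @ map unit_letter u) (map unit_letter (ginv u) @ B 0) ?w"
        using au ub k by (auto simp: isolated_def right_part_def left_part_def)
      then show ?thesis
        by blast
    qed
  qed
qed

end

section \<open>Products of nonzero normal forms\<close>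

context one_vertex_hypergraph
begin

text \<open>Words of top degree on either side supply stem and costem, and their degrees are the
  bounds in \<open>one_vertex_supports\<close>.\<close>

lemma isolated_exists:
  assumes "finite FS" "FS \<noteq> {}" "finite GS" "GS \<noteq> {}"
    "\<And>p. p \<in> FS \<union> GS \<Longrightarrow> irred p"
  shows "\<exists>p q w. isolated (K :: 'k::field itself) FS GS p q w"
proof -
  obtain p where p: "p \<in> FS" "\<And>p'. p' \<in> FS \<Longrightarrow> deg p' \<le> deg p"
    using obtains_MAX[OF assms(1,2), of deg] Max_ge[of "deg ` FS"] assms(1)
    by (metis finite_imageI imageI)
  obtain q where q: "q \<in> GS" "\<And>q'. q' \<in> GS \<Longrightarrow> deg q' \<le> deg q"
    using obtains_MAX[OF assms(3,4), of deg] Max_ge[of "deg ` GS"] assms(3)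
    by (metis finite_imageI imageI)
  interpret one_vertex_supports H S R v K FS GS "deg p" "deg q"
    by unfold_locales (use assms p q in auto)
  obtain A a where A: "p = A @ map unit_letter a" "stem A" "units a"
    using stem_exists assms(5) p by blast
  obtain b B where B: "q = map unit_letter b @ B" "costem B" "units b"
    using costem_exists assms(5) q by blast
  have ne: "right_part A \<noteq> {}" "left_part B \<noteq> {}"
    using A B p(1) q(1) by (auto simp: right_part_def left_part_def)
  have deg: "deg A = deg p" "deg B = deg q"
    using A B by simp_all
  show ?thesis
  proof (cases "opposite A B")
    case True
    then obtain p2 d h l r q2 k where "A = p2 @ [letter d h l k]" "B = letter (\<not> d) h k r # q2"
      by (auto simp: opposite_def)
    then show ?thesis
      using isolated_opposite[of p2 d h l k r q2] A(2) B(2) deg ne by simp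
  next
    case False
    then show ?thesis
      using isolated_not_opposite A(2) B(2) deg ne by blast
  qed
qed

lemma rho_nonzero:
  fixes F G :: "(('v, 'e) lpa_gen, 'k::field) free"
  assumes "F \<in> normal_span" "G \<in> normal_span" "F \<noteq> 0" "G \<noteq> 0"
  shows "rho F G \<noteq> 0"
proof -
  define supp where "supp F = {p. Word (p @ [Vert v]) \<in> Poly_Mapping.keys F}"
    for F :: "(('v, 'e) lpa_gen, 'k) free"
  define emb where "emb p = Word (p @ [Vert v])" for p :: "('v, 'e) lpa_gen list"
  have inj: "inj_on emb A" for A
    by (auto simp: emb_def inj_on_def)
  have keys: "Poly_Mapping.keys E = emb ` supp E" and irr: "\<And>p. p \<in> supp E \<Longrightarrow> irred p"
    if "E \<in> normal_span" for E :: "(('v, 'e) lpa_gen, 'k) free"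
  proof -
    show "Poly_Mapping.keys E = emb ` supp E"
    proof (intro equalityI subsetI)
      fix w
      assume w: "w \<in> Poly_Mapping.keys E"
      then have "normal (letters w)"
        using that by (simp add: normal_span_def)
      then obtain p where "letters w = p @ [Vert v]"
        unfolding normal_iff by blast
      then have "w = emb p"
        unfolding emb_def by (metis word.collapse)
      then show "w \<in> emb ` supp E"
        using w by (auto simp: supp_def emb_def)
    qed (auto simp: supp_def emb_def)
    show "irred p" if "p \<in> supp E" for p
      using \<open>E \<in> normal_span\<close> that by (auto simp: supp_def normal_span_def normal_append_Vert)
  qed
  have fin: "finite (supp E)" "E \<noteq> 0 \<Longrightarrow> supp E \<noteq> {}"
    if "E \<in> normal_span" for E :: "(('v, 'e) lpa_gen, 'k) free"
    using finite_keys[of E] finite_imageD[OF _ inj, of "supp E"] keys_eq_empty[of E]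
    unfolding keys[OF that] by auto
  obtain p q w where iso: "isolated TYPE('k) (supp F) (supp G) p q w"
    using isolated_exists[of "supp F" "supp G" "TYPE('k)"] fin irr assms by blast
  \<comment> \<open>The vertex closing a word of \<open>F\<close> acts as the identity, since every
    normal word starts at \<open>v\<close>.\<close>
  have act: "foldr act (p @ [Vert v]) (wd (q @ [Vert v])) =
      (foldr act p (wd (q @ [Vert v])) :: (('v, 'e) lpa_gen, 'k) free)" if "q \<in> supp G" for p q
    using start_hd_normal[of "q @ [Vert v]"] irr[OF assms(2) that] by (simp add: normal_append_Vert)
  have "Poly_Mapping.lookup (rho F G) (emb w) = (\<Sum>p\<in>supp F. \<Sum>q\<in>supp G.
      Poly_Mapping.lookup F (emb p) * (Poly_Mapping.lookup G (emb q) * coef TYPE('k) p q w))"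
  proof -
    have 1: "rho F G = (\<Sum>p\<in>supp F. fscale (Poly_Mapping.lookup F (emb p)) (foldr act (p @ [Vert v]) G))"
      unfolding rho_def linear_ext_def keys[OF assms(1)] sum.reindex[OF inj] by (simp add: emb_def)
    have 2: "foldr act (p @ [Vert v]) G =
        (\<Sum>q\<in>supp G. fscale (Poly_Mapping.lookup G (emb q)) (foldr act p (wv q)))" for p
      unfolding linear_map_expand[OF linear_map_foldr_act, of _ G] keys[OF assms(2)] sum.reindex[OF inj]
      using act by (intro sum.cong) (simp_all add: emb_def del: foldr_append)
    show ?thesis
      unfolding 1 2 by (simp add: lookup_sum lookup_fscale coef_def emb_def sum_distrib_left)
  qed
  also have "\<dots> = (\<Sum>(p, q)\<in>supp F \<times> supp G.
      Poly_Mapping.lookup F (emb p) * (Poly_Mapping.lookup G (emb q) * coef TYPE('k) p q w))"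
    by (simp add: sum.cartesian_product)
  also have "\<dots> = (\<Sum>(p, q)\<in>{(p, q)}.
      Poly_Mapping.lookup F (emb p) * (Poly_Mapping.lookup G (emb q) * coef TYPE('k) p q w))"
  proof (rule sum.mono_neutral_right)
    show "finite (supp F \<times> supp G)" "{(p, q)} \<subseteq> supp F \<times> supp G"
      using fin assms(1,2) iso by (simp_all add: isolated_def)
    have "coef TYPE('k) p' q' w = 0" if "p' \<in> supp F" "q' \<in> supp G" "(p', q') \<noteq> (p, q)" for p' q'
      using iso that unfolding isolated_def by blast
    then have "Poly_Mapping.lookup F (emb p') * (Poly_Mapping.lookup G (emb q') * coef TYPE('k) p' q' w) = 0"
      if "(p', q') \<in> supp F \<times> supp G - {(p, q)}" for p' q'
      using that by (metis DiffE SigmaD1 SigmaD2 mult_zero_right singletonI)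
    then show "\<forall>x\<in>supp F \<times> supp G - {(p, q)}. (case x of (p, q) \<Rightarrow>
        Poly_Mapping.lookup F (emb p) * (Poly_Mapping.lookup G (emb q) * coef TYPE('k) p q w)) = 0"
      by (intro ballI) (simp only: split_paired_all prod.case)
  qed
  also have "\<dots> \<noteq> 0"
    using iso by (auto simp: isolated_def supp_def emb_def in_keys_iff)
  finally show ?thesis
    by auto
qed

text \<open>\<open>f\<close> and its normal form differ by an element of the ideal, which acts as
  zero. So \<open>rho ?F ?G\<close> equals \<open>rho f ?G\<close>, the normal form of
  \<open>f * g\<close>.\<close>

lemma one_vertex_no_zero_divisors:
  assumes "f \<in> free_carr (lpa_gens H)" "g \<in> free_carr (lpa_gens H)" "f * g \<in> lpa_ideal"
  shows "f \<in> lpa_ideal \<or> g \<in> lpa_ideal"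
proof -
  let ?F = "rho f (vert v)" and ?G = "rho g (vert v)"
  have span: "?F \<in> normal_span" "?G \<in> normal_span"
    using assms vert_normal_span by (auto intro: rho_normal_span)
  have "rho f ?G = 0"
    using rho_ideal[OF assms(3) vert_normal_span] by (simp add: rho_mult)
  moreover have "rho (f - ?F) ?G = 0"
    by (rule rho_ideal[OF rho_vert_ideal[OF assms(1)] span(2)])
  ultimately have "rho ?F ?G = 0"
    by (simp add: rho_left_simps)
  then have "?F = 0 \<or> ?G = 0"
    using rho_nonzero span by blast
  then show ?thesis
    using rho_vert_ideal assms(1,2) by (metis diff_zero)
qed

end

theorem theorem48:
  fixes H :: "('v, 'e) hypergraph" and S R :: "'e \<Rightarrow> 'v list"
  assumes "listed_hypergraph H S R"
  shows "nu_domain (leavitt_path_algebra H S R :: ('k::field, (('v, 'e) lpa_gen, 'k) free set) nu_alg) \<longleftrightarrow>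
    card (verts H) = 1 \<and>
    (\<forall>h\<in>hedges H. (size (src H h) \<ge> 2 \<and> size (rng H h) \<ge> 2) \<or>
                   (size (src H h) = 1 \<and> size (rng H h) = 1))"
    (is "?dom \<longleftrightarrow> card (verts H) = 1 \<and> ?sizes")
proof -
  interpret listed_hypergraph H S R
    by (rule assms)
  show ?thesis
  proof
    assume ?dom
    note dom = this[unfolded nu_domain_iff, rule_format]
    show "card (verts H) = 1 \<and> ?sizes"
      using no_zero_divisors_imp[OF dom] by (simp add: rows_def)
  next
    assume *: "card (verts H) = 1 \<and> ?sizes"
    then obtain v where "verts H = {v}"
      by (auto simp: card_1_singleton_iff)
    then interpret one_vertex_hypergraph H S R v
      by unfold_locales (use * in \<open>auto simp: rows_def\<close>)
    show ?dom
      unfolding nu_domain_iff using one_vertex_no_zero_divisors by blast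
  qed
qed

end
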